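(* Let $G$ be a profinite group endowed with a bi-invariant metric. Assume that $G$ contains a sequence $(g_n)$ in $G\setminus\{1\}$ converging to $1$. Then the continuous projection map $L(G)\to L(G)/G$ does not admit any local cross-section. However, this map is a Hurewicz fibration, admitting in addition the unique homotopy lifting property with respect to any space: for every topological space $X$, every continuous $\varphi:X\to L(G)$ and every continuous $H:X\times[0,1]\to L(G)/G$ such that $H(\cdot,0)$ is the composite of $\varphi$ with the projection, there exists a unique continuous $\tilde H:X\times[0,1]\to L(G)$ lifting $H$ with $\tilde H(\cdot,0)=\varphi$.
   Context: The bi-invariant metric $d$ on $G$ is assumed to define the profinite topology of $G$. $\Omega$ denotes an uncountable standard Borel space endowed with a non-atomic probability measure; integration against it is written $dt$. $L(G)=L(\Omega,G)$ is the set of Borel maps $\Omega\to G$ modulo almost-everywhere equality, with the metric $d(f_1,f_2)=\int_\Omega d(f_1(t),f_2(t))\,dt$. $G$ acts on $L(G)$ by $(g.f)(t)=g f(t)$ and $L(G)/G$ is the quotient space, with metric $d(\bar f_1,\bar f_2)=\inf_{g\in G}d(g.f_1,f_2)$. A local cross-section is a continuous section of the projection defined over some nonempty open subset of $L(G)/G$. A Hurewicz fibration is a continuous map with the homotopy lifting property with respect to every topological space. *)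

theory Defs
  imports "HOL-Probability.Probability" "HOL-Algebra.Group_Action"
begin

definition borel_of :: "'a topology \<Rightarrow> 'a measure" where
  "borel_of T = sigma (topspace T) {U. openin T U}"

definition standard_borel :: "'a measure \<Rightarrow> bool" where
  "standard_borel M \<longleftrightarrow>
     (\<exists>T. completely_metrizable_space T \<and> separable_space T \<and> sets M = sets (borel_of T))"

definition non_atomic :: "'a measure \<Rightarrow> bool" where
  "non_atomic M \<longleftrightarrow>
     (\<forall>A\<in>sets M. emeasure M A > 0 \<longrightarrow>
        (\<exists>B\<in>sets M. B \<subseteq> A \<and> 0 < emeasure M B \<and> emeasure M B < emeasure M A))"

definition topological_group :: "('g, 'm) monoid_scheme \<Rightarrow> 'g topology \<Rightarrow> bool" where
  "topological_group G T \<longleftrightarrow>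
     group G \<and> topspace T = carrier G \<and>
     continuous_map (prod_topology T T) T (\<lambda>(x, y). x \<otimes>\<^bsub>G\<^esub> y) \<and>
     continuous_map T T (\<lambda>x. inv\<^bsub>G\<^esub> x)"

text \<open>Profinite: a compact, Hausdorff, totally disconnected topological group.\<close>

definition profinite_group :: "('g, 'm) monoid_scheme \<Rightarrow> 'g topology \<Rightarrow> bool" where
  "profinite_group G T \<longleftrightarrow>
     topological_group G T \<and> compact_space T \<and> Hausdorff_space T \<and>
     (\<forall>C. connectedin T C \<longrightarrow> (\<exists>a. C \<subseteq> {a}))"

definition bi_invariant :: "('g, 'm) monoid_scheme \<Rightarrow> ('g \<Rightarrow> 'g \<Rightarrow> real) \<Rightarrow> bool" where
  "bi_invariant G d \<longleftrightarrow>
     (\<forall>g\<in>carrier G. \<forall>x\<in>carrier G. \<forall>y\<in>carrier G.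
        d (g \<otimes>\<^bsub>G\<^esub> x) (g \<otimes>\<^bsub>G\<^esub> y) = d x y \<and> d (x \<otimes>\<^bsub>G\<^esub> g) (y \<otimes>\<^bsub>G\<^esub> g) = d x y)"

definition group_topology :: "('g, 'm) monoid_scheme \<Rightarrow> ('g \<Rightarrow> 'g \<Rightarrow> real) \<Rightarrow> 'g topology" where
  "group_topology G d = Metric_space.mtopology (carrier G) d"

text \<open>
  Points of \<open>L(\<Omega>, G)\<close> are equivalence classes of measurable maps. A measurable map is a total
  HOL function; its values outside \<open>space M\<close> are irrelevant for almost-everywhere equality.
\<close>

definition borel_maps ::
    "'w measure \<Rightarrow> ('g, 'm) monoid_scheme \<Rightarrow> ('g \<Rightarrow> 'g \<Rightarrow> real) \<Rightarrow> ('w \<Rightarrow> 'g) set" where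
  "borel_maps M G d = measurable M (borel_of (group_topology G d))"

definition ae_rel ::
    "'w measure \<Rightarrow> ('g, 'm) monoid_scheme \<Rightarrow> ('g \<Rightarrow> 'g \<Rightarrow> real) \<Rightarrow> (('w \<Rightarrow> 'g) \<times> ('w \<Rightarrow> 'g)) set" where
  "ae_rel M G d =
     {(f, h). f \<in> borel_maps M G d \<and> h \<in> borel_maps M G d \<and> (AE t in M. f t = h t)}"

definition L_space ::
    "'w measure \<Rightarrow> ('g, 'm) monoid_scheme \<Rightarrow> ('g \<Rightarrow> 'g \<Rightarrow> real) \<Rightarrow> ('w \<Rightarrow> 'g) set set" where
  "L_space M G d = borel_maps M G d // ae_rel M G d"

text \<open>The value does not depend on the representatives: see \<open>L_dist_eq\<close> below.\<close>

definition L_dist ::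
    "'w measure \<Rightarrow> ('g \<Rightarrow> 'g \<Rightarrow> real) \<Rightarrow> ('w \<Rightarrow> 'g) set \<Rightarrow> ('w \<Rightarrow> 'g) set \<Rightarrow> real" where
  "L_dist M d F1 F2 = (LINT t|M. d ((SOME f. f \<in> F1) t) ((SOME f. f \<in> F2) t))"

definition L_act ::
    "'w measure \<Rightarrow> ('g, 'm) monoid_scheme \<Rightarrow> ('g \<Rightarrow> 'g \<Rightarrow> real) \<Rightarrow>
     'g \<Rightarrow> ('w \<Rightarrow> 'g) set \<Rightarrow> ('w \<Rightarrow> 'g) set" where
  "L_act M G d g F = (\<Union>f\<in>F. ae_rel M G d `` {\<lambda>t. g \<otimes>\<^bsub>G\<^esub> f t})"

definition L_quotient ::
    "'w measure \<Rightarrow> ('g, 'm) monoid_scheme \<Rightarrow> ('g \<Rightarrow> 'g \<Rightarrow> real) \<Rightarrow> ('w \<Rightarrow> 'g) set set set" where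
  "L_quotient M G d = orbits G (L_space M G d) (L_act M G d)"

definition L_proj ::
    "'w measure \<Rightarrow> ('g, 'm) monoid_scheme \<Rightarrow> ('g \<Rightarrow> 'g \<Rightarrow> real) \<Rightarrow>
     ('w \<Rightarrow> 'g) set \<Rightarrow> ('w \<Rightarrow> 'g) set set" where
  "L_proj M G d = orbit G (L_act M G d)"

text \<open>
  The infimum metric is evaluated on representatives of the orbits (the value does not depend
  on them: see \<open>L_quotient_dist_eq\<close> below). It is set to 0 off the orbit space because
  \<^locale>\<open>Metric_space\<close> demands symmetry and nonnegativity on the whole type.
\<close>

definition L_quotient_dist ::
    "'w measure \<Rightarrow> ('g, 'm) monoid_scheme \<Rightarrow> ('g \<Rightarrow> 'g \<Rightarrow> real) \<Rightarrow>
     ('w \<Rightarrow> 'g) set set \<Rightarrow> ('w \<Rightarrow> 'g) set set \<Rightarrow> real" where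
  "L_quotient_dist M G d O1 O2 =
     (if O1 \<in> L_quotient M G d \<and> O2 \<in> L_quotient M G d
      then INF g\<in>carrier G. L_dist M d (L_act M G d g (SOME F. F \<in> O1)) (SOME F. F \<in> O2)
      else 0)"

definition L_topology ::
    "'w measure \<Rightarrow> ('g, 'm) monoid_scheme \<Rightarrow> ('g \<Rightarrow> 'g \<Rightarrow> real) \<Rightarrow> ('w \<Rightarrow> 'g) set topology" where
  "L_topology M G d = Metric_space.mtopology (L_space M G d) (L_dist M d)"

definition L_quotient_topology ::
    "'w measure \<Rightarrow> ('g, 'm) monoid_scheme \<Rightarrow> ('g \<Rightarrow> 'g \<Rightarrow> real) \<Rightarrow> ('w \<Rightarrow> 'g) set set topology" where
  "L_quotient_topology M G d = Metric_space.mtopology (L_quotient M G d) (L_quotient_dist M G d)"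

definition local_cross_section ::
    "'e topology \<Rightarrow> 'b topology \<Rightarrow> ('e \<Rightarrow> 'b) \<Rightarrow> 'b set \<Rightarrow> ('b \<Rightarrow> 'e) \<Rightarrow> bool" where
  "local_cross_section E B p U s \<longleftrightarrow>
     openin B U \<and> U \<noteq> {} \<and> continuous_map (subtopology B U) E s \<and> (\<forall>u\<in>U. p (s u) = u)"

definition lifting_problem ::
    "'x topology \<Rightarrow> 'e topology \<Rightarrow> 'b topology \<Rightarrow> ('e \<Rightarrow> 'b) \<Rightarrow> ('x \<Rightarrow> 'e) \<Rightarrow> ('x \<times> real \<Rightarrow> 'b) \<Rightarrow> bool"
  where "lifting_problem X E B p \<phi> H \<longleftrightarrow>
     continuous_map X E \<phi> \<and>
     continuous_map (prod_topology X (top_of_set {0..1})) B H \<and>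
     (\<forall>x\<in>topspace X. H (x, 0) = p (\<phi> x))"

definition is_lift ::
    "'x topology \<Rightarrow> 'e topology \<Rightarrow> ('e \<Rightarrow> 'b) \<Rightarrow> ('x \<Rightarrow> 'e) \<Rightarrow> ('x \<times> real \<Rightarrow> 'b) \<Rightarrow>
     ('x \<times> real \<Rightarrow> 'e) \<Rightarrow> bool"
  where "is_lift X E p \<phi> H K \<longleftrightarrow>
     continuous_map (prod_topology X (top_of_set {0..1})) E K \<and>
     (\<forall>z\<in>topspace X \<times> {0..1}. p (K z) = H z) \<and>
     (\<forall>x\<in>topspace X. K (x, 0) = \<phi> x)"

definition homotopy_lifting_property ::
    "'x topology \<Rightarrow> 'e topology \<Rightarrow> 'b topology \<Rightarrow> ('e \<Rightarrow> 'b) \<Rightarrow> bool" where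
  "homotopy_lifting_property X E B p \<longleftrightarrow>
     (\<forall>\<phi> H. lifting_problem X E B p \<phi> H \<longrightarrow> (\<exists>K. is_lift X E p \<phi> H K))"

text \<open>Uniqueness of the lift is uniqueness on \<open>X \<times> [0,1]\<close>, since HOL functions are total.\<close>

definition unique_homotopy_lifting_property ::
    "'x topology \<Rightarrow> 'e topology \<Rightarrow> 'b topology \<Rightarrow> ('e \<Rightarrow> 'b) \<Rightarrow> bool" where
  "unique_homotopy_lifting_property X E B p \<longleftrightarrow>
     (\<forall>\<phi> H. lifting_problem X E B p \<phi> H \<longrightarrow>
        (\<exists>K. is_lift X E p \<phi> H K \<and>
             (\<forall>K'. is_lift X E p \<phi> H K' \<longrightarrow> (\<forall>z\<in>topspace X \<times> {0..1}. K' z = K z))))"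

text \<open>
  HOL cannot quantify over types inside a formula, so the carrier type of the test spaces is a
  type argument. A theorem stated for a free type variable \<open>'x\<close> covers every topological space.
\<close>

definition hurewicz_fibration ::
    "'x itself \<Rightarrow> 'e topology \<Rightarrow> 'b topology \<Rightarrow> ('e \<Rightarrow> 'b) \<Rightarrow> bool" where
  "hurewicz_fibration _ E B p \<longleftrightarrow>
     continuous_map E B p \<and> (\<forall>X :: 'x topology. homotopy_lifting_property X E B p)"

text \<open>
  Well-definedness: \<open>L_dist\<close> and \<open>L_quotient_dist\<close> do not depend on the chosen representatives and
  are metrics, so that the topologies above are the metric topologies intended.
\<close>

lemma space_borel_of: "space (borel_of T) = topspace T"
  unfolding borel_of_def by (rule space_measure_of) (auto dest: openin_subset)

lemma openin_borel_of: "openin T U \<Longrightarrow> U \<in> sets (borel_of T)"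
  unfolding borel_of_def by (subst sets_measure_of) (auto dest: openin_subset)

lemma measurable_borel_ofI:
  assumes "f \<in> space S \<rightarrow> topspace T"
    and "\<And>U. openin T U \<Longrightarrow> f -` U \<inter> space S \<in> sets S"
  shows "f \<in> measurable S (borel_of T)"
  unfolding borel_of_def
  by (rule measurable_measure_of) (use assms in \<open>auto dest: openin_subset\<close>)

locale L_setting = group G + Metric_space "carrier G" d + prob_space M
  for G :: "('g, 'm) monoid_scheme" (structure) and d :: "'g \<Rightarrow> 'g \<Rightarrow> real" and M :: "'w measure" +
  assumes compact: "compact_space mtopology"
    and biinv: "bi_invariant G d"
begin

abbreviation "N \<equiv> borel_of mtopology"

lemma borel_maps_eq: "borel_maps M G d = measurable M N"
  by (simp add: borel_maps_def group_topology_def)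

lemma left_inv: "\<lbrakk>g \<in> carrier G; x \<in> carrier G; y \<in> carrier G\<rbrakk> \<Longrightarrow> d (g \<otimes> x) (g \<otimes> y) = d x y"
  and right_inv: "\<lbrakk>g \<in> carrier G; x \<in> carrier G; y \<in> carrier G\<rbrakk> \<Longrightarrow> d (x \<otimes> g) (y \<otimes> g) = d x y"
  using biinv unfolding bi_invariant_def by auto

lemma meas_carrier: "f \<in> borel_maps M G d \<Longrightarrow> t \<in> space M \<Longrightarrow> f t \<in> carrier G"
  using measurable_space[of f M N t] by (simp add: space_borel_of borel_maps_eq)

lemma dense_seq: obtains D where "countable D" "D \<subseteq> carrier G"
  "\<And>x e. x \<in> carrier G \<Longrightarrow> e > 0 \<Longrightarrow> \<exists>y\<in>D. d x y < e"
proof -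
  have "mtotally_bounded (carrier G)"
    using compact compact_space_eq_mcomplete_mtotally_bounded by blast
  then have "\<forall>n::nat. \<exists>K. finite K \<and> K \<subseteq> carrier G \<and> carrier G \<subseteq> (\<Union>x\<in>K. mball x (1 / Suc n))"
    unfolding mtotally_bounded_def by (metis of_nat_0_less_iff zero_less_Suc zero_less_divide_1_iff)
  then obtain K where K: "\<And>n::nat. finite (K n) \<and> K n \<subseteq> carrier G \<and>
      carrier G \<subseteq> (\<Union>x\<in>K n. mball x (1 / Suc n))" by metis
  show ?thesis
  proof
    show "countable (\<Union>n. K n)" using K by (auto intro: countable_finite)
    show "(\<Union>n. K n) \<subseteq> carrier G" using K by blast
    fix x e assume x: "x \<in> carrier G" and e: "e > (0::real)"
    obtain n where n: "1 / Suc n < e" using e by (metis inverse_eq_divide reals_Archimedean)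
    from K[of n] x obtain y where "y \<in> K n" "x \<in> mball y (1 / Suc n)" by blast
    then show "\<exists>y\<in>\<Union>n. K n. d x y < e" using n commute[of x y] by (intro bexI[of _ y]) auto
  qed
qed

lemma meas_d: assumes f: "f \<in> borel_maps M G d" and h: "h \<in> borel_maps M G d"
  shows "(\<lambda>t. d (f t) (h t)) \<in> borel_measurable M"
proof -
  obtain D where D: "countable D" "D \<subseteq> carrier G"
    "\<And>x e. x \<in> carrier G \<Longrightarrow> e > 0 \<Longrightarrow> \<exists>y\<in>D. d x y < e" using dense_seq by blast
  have m1: "(\<lambda>t. d (k t) y) \<in> borel_measurable M" if k: "k \<in> borel_maps M G d" and y: "y \<in> D" for k y
    unfolding borel_measurable_iff_less
  proof
    fix a
    have "{t \<in> space M. d (k t) y < a} = k -` mball y a \<inter> space M"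
      using meas_carrier[OF k] y D(2) by (auto simp: commute)
    then show "{t \<in> space M. d (k t) y < a} \<in> sets M"
      using measurable_sets[OF k[unfolded borel_maps_eq] openin_borel_of[OF openin_mball]] by simp
  qed
  show ?thesis
    unfolding borel_measurable_iff_less
  proof
    fix a
    have "d x y < a \<longleftrightarrow> (\<exists>z\<in>D. d x z + d y z < a)" if xy: "x \<in> carrier G" "y \<in> carrier G" for x y
    proof
      assume "d x y < a"
      then obtain z where z: "z \<in> D" "d x z < (a - d x y) / 2" using D(3)[OF xy(1)]
        by (metis diff_gt_0_iff_gt half_gt_zero_iff)
      have "d y z \<le> d y x + d x z" using triangle xy z D by blast
      then show "\<exists>z\<in>D. d x z + d y z < a" using z commute[of x y]
        by (intro bexI[of _ z]) (auto simp: field_simps)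
    next
      assume "\<exists>z\<in>D. d x z + d y z < a"
      then obtain z where z: "z \<in> D" "d x z + d y z < a" by blast
      then show "d x y < a" using triangle[of x z y] xy D(2) commute[of y z] by fastforce
    qed
    then have "{t \<in> space M. d (f t) (h t) < a} = (\<Union>z\<in>D. {t \<in> space M. d (f t) z + d (h t) z < a})"
      using meas_carrier[OF f] meas_carrier[OF h] by auto
    also have "\<dots> \<in> sets M"
    proof (rule sets.countable_UN''[OF D(1)])
      fix z assume z: "z \<in> D"
      have "(\<lambda>t. d (f t) z + d (h t) z) \<in> borel_measurable M"
        using m1[OF f z] m1[OF h z] by (rule borel_measurable_add)
      then show "{t \<in> space M. d (f t) z + d (h t) z < a} \<in> sets M"
        unfolding borel_measurable_iff_less by blast
    qed
    finally show "{t \<in> space M. d (f t) (h t) < a} \<in> sets M" .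
  qed
qed

lemma bdd: obtains B where "\<And>x y. x \<in> carrier G \<Longrightarrow> y \<in> carrier G \<Longrightarrow> d x y \<le> B"
proof -
  have "mbounded (carrier G)"
    using compact compact_space_eq_mcomplete_mtotally_bounded mtotally_bounded_imp_mbounded by blast
  then show ?thesis using that unfolding mbounded_alt by blast
qed

lemma integrable_d: assumes f: "f \<in> borel_maps M G d" and h: "h \<in> borel_maps M G d"
  shows "integrable M (\<lambda>t. d (f t) (h t))"
proof -
  obtain B where B: "\<And>x y. x \<in> carrier G \<Longrightarrow> y \<in> carrier G \<Longrightarrow> d x y \<le> B" using bdd by blast
  show ?thesis
    by (rule integrable_const_bound[where B=B])
      (use B meas_carrier[OF f] meas_carrier[OF h] meas_d[OF f h] in auto)
qed

lemma equiv_ae: "equiv (borel_maps M G d) (ae_rel M G d)"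
  by (rule equivI) (auto simp: ae_rel_def refl_on_def sym_def trans_def elim: AE_mp)

lemma L_spaceE: assumes "F \<in> L_space M G d"
  obtains f where "f \<in> borel_maps M G d" "F = ae_rel M G d `` {f}" "f \<in> F"
  using assms equiv_class_self[OF equiv_ae] unfolding L_space_def by (auto elim!: quotientE)

lemma L_in_meas: "F \<in> L_space M G d \<Longrightarrow> f \<in> F \<Longrightarrow> f \<in> borel_maps M G d"
  using in_quotient_imp_subset[OF equiv_ae] unfolding L_space_def by blast

lemma L_AE: "F \<in> L_space M G d \<Longrightarrow> f \<in> F \<Longrightarrow> h \<in> F \<Longrightarrow> AE t in M. f t = h t"
  using in_quotient_imp_in_rel[OF equiv_ae, of F f h] unfolding L_space_def
  by (auto simp: ae_rel_def)

lemma L_some: "F \<in> L_space M G d \<Longrightarrow> (SOME f. f \<in> F) \<in> F"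
  by (metis L_spaceE someI)

lemma L_dist_eq:
  assumes "F1 \<in> L_space M G d" "F2 \<in> L_space M G d" "f1 \<in> F1" "f2 \<in> F2"
  shows "L_dist M d F1 F2 = (LINT t|M. d (f1 t) (f2 t))"
proof -
  let ?s1 = "SOME f. f \<in> F1" and ?s2 = "SOME f. f \<in> F2"
  have s: "?s1 \<in> F1" "?s2 \<in> F2" using assms L_some by auto
  have "AE t in M. ?s1 t = f1 t" "AE t in M. ?s2 t = f2 t" using L_AE assms s by auto
  then have "AE t in M. d (?s1 t) (?s2 t) = d (f1 t) (f2 t)" by eventually_elim simp
  then show ?thesis unfolding L_dist_def
    using assms s by (intro integral_cong_AE meas_d L_in_meas) auto
qed

lemma L_metric: "Metric_space (L_space M G d) (L_dist M d)"
proof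
  fix F1 F2 F3
  show "0 \<le> L_dist M d F1 F2" unfolding L_dist_def by (rule Bochner_Integration.integral_nonneg) simp
  show "L_dist M d F1 F2 = L_dist M d F2 F1" unfolding L_dist_def by (simp add: commute)
next
  fix F1 F2 assume F: "F1 \<in> L_space M G d" "F2 \<in> L_space M G d"
  obtain f1 where f1: "f1 \<in> borel_maps M G d" "F1 = ae_rel M G d `` {f1}" "f1 \<in> F1" using F L_spaceE by blast
  obtain f2 where f2: "f2 \<in> borel_maps M G d" "F2 = ae_rel M G d `` {f2}" "f2 \<in> F2" using F L_spaceE by blast
  have "L_dist M d F1 F2 = 0 \<longleftrightarrow> (AE t in M. d (f1 t) (f2 t) = 0)"
    using F f1 f2 by (simp add: L_dist_eq integrable_d integral_nonneg_eq_0_iff_AE)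
  also have "\<dots> \<longleftrightarrow> (AE t in M. f1 t = f2 t)"
    by (rule AE_cong) (use f1 f2 meas_carrier in auto)
  also have "\<dots> \<longleftrightarrow> F1 = F2"
    using eq_equiv_class_iff[OF equiv_ae f1(1) f2(1)] f1 f2 by (auto simp: ae_rel_def)
  finally show "L_dist M d F1 F2 = 0 \<longleftrightarrow> F1 = F2" .
next
  fix F1 F2 F3 assume F: "F1 \<in> L_space M G d" "F2 \<in> L_space M G d" "F3 \<in> L_space M G d"
  obtain f1 where f1: "f1 \<in> borel_maps M G d" "f1 \<in> F1" using F L_spaceE by blast
  obtain f2 where f2: "f2 \<in> borel_maps M G d" "f2 \<in> F2" using F L_spaceE by blast
  obtain f3 where f3: "f3 \<in> borel_maps M G d" "f3 \<in> F3" using F L_spaceE by blast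
  have "(LINT t|M. d (f1 t) (f3 t)) \<le> (LINT t|M. d (f1 t) (f2 t) + d (f2 t) (f3 t))"
    by (rule integral_mono) (use f1 f2 f3 meas_carrier triangle integrable_d in auto)
  then show "L_dist M d F1 F3 \<le> L_dist M d F1 F2 + L_dist M d F2 F3"
    using F f1 f2 f3 by (simp add: L_dist_eq integrable_d)
qed

lemma meas_translate: assumes g: "g \<in> carrier G" and f: "f \<in> borel_maps M G d"
  shows "(\<lambda>t. g \<otimes> f t) \<in> borel_maps M G d"
proof -
  have cont: "continuous_map mtopology mtopology (\<lambda>x. g \<otimes> x)"
    by (subst metric_continuous_map[OF Metric_space_axioms]) (use g left_inv in auto)
  have "(\<lambda>x. g \<otimes> x) -` U \<inter> carrier G \<in> sets N" if "openin mtopology U" for U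
    using openin_borel_of[OF openin_continuous_map_preimage[OF cont that]]
    by (simp add: vimage_def Int_def conj_commute)
  then have "(\<lambda>x. g \<otimes> x) \<in> measurable N N"
    by (intro measurable_borel_ofI) (use g in \<open>auto simp: space_borel_of\<close>)
  then show ?thesis using f measurable_compose unfolding borel_maps_eq by blast
qed


lemma L_act_eq: assumes g: "g \<in> carrier G" and F: "F \<in> L_space M G d" and f: "f \<in> F"
  shows "L_act M G d g F = ae_rel M G d `` {\<lambda>t. g \<otimes> f t}"
proof -
  have "ae_rel M G d `` {\<lambda>t. g \<otimes> h t} = ae_rel M G d `` {\<lambda>t. g \<otimes> f t}" if h: "h \<in> F" for h
  proof (rule equiv_class_eq[OF equiv_ae])
    have "AE t in M. g \<otimes> h t = g \<otimes> f t"
      using L_AE[OF F h f] by eventually_elim simp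
    then show "(\<lambda>t. g \<otimes> h t, \<lambda>t. g \<otimes> f t) \<in> ae_rel M G d"
      using g L_in_meas[OF F] h f by (simp add: ae_rel_def meas_translate)
  qed
  then show ?thesis using f unfolding L_act_def by blast
qed

lemma L_act_closed: assumes "g \<in> carrier G" "F \<in> L_space M G d"
  shows "L_act M G d g F \<in> L_space M G d"
proof -
  obtain f where f: "f \<in> borel_maps M G d" "f \<in> F" using assms L_spaceE by blast
  then show ?thesis using assms meas_translate
    by (simp add: L_act_eq[OF assms f(2)] L_space_def quotientI)
qed

lemma L_act_mem: assumes "g \<in> carrier G" "F \<in> L_space M G d" "f \<in> F"
  shows "(\<lambda>t. g \<otimes> f t) \<in> L_act M G d g F"
  using equiv_class_self[OF equiv_ae] assms meas_translate L_in_meas by (simp add: L_act_eq)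

lemma L_act_one: assumes F: "F \<in> L_space M G d" shows "L_act M G d \<one> F = F"
proof -
  obtain f where f: "f \<in> borel_maps M G d" "F = ae_rel M G d `` {f}" "f \<in> F" using F L_spaceE by blast
  have "(\<lambda>t. \<one> \<otimes> f t, f) \<in> ae_rel M G d"
    using f meas_translate meas_carrier[OF f(1)] by (simp add: ae_rel_def)
  then show ?thesis using equiv_class_eq[OF equiv_ae] L_act_eq[OF one_closed F f(3)] f(2) by simp
qed

lemma L_act_mult: assumes "g \<in> carrier G" "h \<in> carrier G" and F: "F \<in> L_space M G d"
  shows "L_act M G d g (L_act M G d h F) = L_act M G d (g \<otimes> h) F"
proof -
  obtain f where f: "f \<in> borel_maps M G d" "f \<in> F" using F L_spaceE by blast
  have "(\<lambda>t. g \<otimes> (h \<otimes> f t), \<lambda>t. g \<otimes> h \<otimes> f t) \<in> ae_rel M G d"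
    using f assms meas_translate meas_carrier[OF f(1)] by (simp add: ae_rel_def m_assoc)
  then show ?thesis
    using assms f equiv_class_eq[OF equiv_ae]
    unfolding L_act_eq[OF assms(1) L_act_closed[OF assms(2) F] L_act_mem[OF assms(2) F f(2)]]
    by (simp add: L_act_eq[OF _ F f(2)])
qed

lemma L_dist_act: assumes g: "g \<in> carrier G" and F: "F1 \<in> L_space M G d" "F2 \<in> L_space M G d"
  shows "L_dist M d (L_act M G d g F1) (L_act M G d g F2) = L_dist M d F1 F2"
proof -
  obtain f1 where f1: "f1 \<in> borel_maps M G d" "f1 \<in> F1" using F L_spaceE by blast
  obtain f2 where f2: "f2 \<in> borel_maps M G d" "f2 \<in> F2" using F L_spaceE by blast
  have "L_dist M d (L_act M G d g F1) (L_act M G d g F2) = (LINT t|M. d (g \<otimes> f1 t) (g \<otimes> f2 t))"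
    using g F f1 f2 by (intro L_dist_eq L_act_closed L_act_mem)
  also have "\<dots> = (LINT t|M. d (f1 t) (f2 t))"
    using g f1 f2 meas_carrier left_inv by (intro Bochner_Integration.integral_cong) auto
  also have "\<dots> = L_dist M d F1 F2" using F f1 f2 by (simp add: L_dist_eq)
  finally show ?thesis .
qed

lemma L_dist_act_same: assumes g: "g \<in> carrier G" "h \<in> carrier G" and F: "F \<in> L_space M G d"
  shows "L_dist M d (L_act M G d g F) (L_act M G d h F) = d g h"
proof -
  obtain f where f: "f \<in> borel_maps M G d" "f \<in> F" using F L_spaceE by blast
  have "L_dist M d (L_act M G d g F) (L_act M G d h F) = (LINT t|M. d (g \<otimes> f t) (h \<otimes> f t))"
    using g F f by (intro L_dist_eq L_act_closed L_act_mem)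
  also have "\<dots> = (LINT t|M. d g h)"
    using g f meas_carrier right_inv by (intro Bochner_Integration.integral_cong) auto
  finally show ?thesis by (simp add: prob_space)
qed

lemma L_quotientE: assumes "C \<in> L_quotient M G d" "F \<in> C"
  shows "F \<in> L_space M G d" "C = L_proj M G d F"
proof -
  obtain F0 where F0: "F0 \<in> L_space M G d" "C = orbit G (L_act M G d) F0"
    using assms unfolding L_quotient_def orbits_def by blast
  then obtain h where h: "h \<in> carrier G" "F = L_act M G d h F0"
    using assms unfolding orbit_def by blast
  show "F \<in> L_space M G d" using h F0 L_act_closed by simp
  have *: "L_act M G d g F = L_act M G d (g \<otimes> h) F0" if "g \<in> carrier G" for g
    using that h F0 L_act_mult by simp
  have **: "L_act M G d g F0 = L_act M G d (g \<otimes> inv h) F" if "g \<in> carrier G" for g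
    using that h F0 L_act_mult by (simp add: m_assoc)
  show "C = L_proj M G d F"
    unfolding F0(2) L_proj_def orbit_def using * ** h(1) by (auto; metis m_closed inv_closed)
qed

lemma L_proj_mem: "F \<in> L_space M G d \<Longrightarrow> F \<in> L_proj M G d F"
  unfolding L_proj_def orbit_def using L_act_one by force

lemma L_proj_in: "F \<in> L_space M G d \<Longrightarrow> L_proj M G d F \<in> L_quotient M G d"
  unfolding L_proj_def L_quotient_def orbits_def by blast

lemma L_quotient_rep: assumes "C \<in> L_quotient M G d"
  obtains F where "F \<in> L_space M G d" "F \<in> C" "C = L_proj M G d F"
  using assms L_proj_mem unfolding L_quotient_def orbits_def L_proj_def by blast

lemma L_quotient_dist_eq:
  assumes C: "C1 \<in> L_quotient M G d" "C2 \<in> L_quotient M G d" and F: "F1 \<in> C1" "F2 \<in> C2"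
  shows "L_quotient_dist M G d C1 C2 = (INF g\<in>carrier G. L_dist M d (L_act M G d g F1) F2)"
proof -
  let ?S1 = "SOME F. F \<in> C1" and ?S2 = "SOME F. F \<in> C2"
  have S: "?S1 \<in> C1" "?S2 \<in> C2" using F by (auto intro: someI)
  note F' = L_quotientE[OF C(1) F(1)] L_quotientE[OF C(2) F(2)]
  obtain a where a: "a \<in> carrier G" "?S1 = L_act M G d a F1"
    using S F' unfolding L_proj_def orbit_def by blast
  obtain b where b: "b \<in> carrier G" "?S2 = L_act M G d b F2"
    using S F' unfolding L_proj_def orbit_def by blast
  have *: "L_dist M d (L_act M G d g ?S1) ?S2 = L_dist M d (L_act M G d (inv b \<otimes> (g \<otimes> a)) F1) F2"
    if g: "g \<in> carrier G" for g
  proof -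
    have "L_dist M d (L_act M G d g ?S1) ?S2 =
        L_dist M d (L_act M G d (inv b) (L_act M G d g ?S1)) (L_act M G d (inv b) ?S2)"
      using g a b F' by (simp add: L_dist_act L_act_closed)
    then show ?thesis using g a b F' by (simp add: L_act_mult L_act_closed L_act_one)
  qed
  have "(\<lambda>g. inv b \<otimes> (g \<otimes> a)) ` carrier G = carrier G"
  proof
    show "carrier G \<subseteq> (\<lambda>g. inv b \<otimes> (g \<otimes> a)) ` carrier G"
    proof
      fix g assume "g \<in> carrier G"
      then have "g = inv b \<otimes> ((b \<otimes> g \<otimes> inv a) \<otimes> a)" "b \<otimes> g \<otimes> inv a \<in> carrier G"
        using a b by (auto simp: m_assoc inv_solve_left)
      then show "g \<in> (\<lambda>g. inv b \<otimes> (g \<otimes> a)) ` carrier G" by blast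
    qed
  qed (use a b in auto)
  then have "(\<lambda>g. L_dist M d (L_act M G d g F1) F2) ` carrier G =
      (\<lambda>g. L_dist M d (L_act M G d g F1) F2) ` (\<lambda>g. inv b \<otimes> (g \<otimes> a)) ` carrier G"
    by (rule arg_cong[OF sym])
  also have "\<dots> = (\<lambda>g. L_dist M d (L_act M G d g ?S1) ?S2) ` carrier G"
    unfolding image_image using * by (intro image_cong) auto
  finally have "(\<lambda>g. L_dist M d (L_act M G d g F1) F2) ` carrier G =
      (\<lambda>g. L_dist M d (L_act M G d g ?S1) ?S2) ` carrier G" .
  then show ?thesis using C by (simp add: L_quotient_dist_def)
qed

lemma inf_attained:
  assumes F: "F1 \<in> L_space M G d" "F2 \<in> L_space M G d"
  obtains g where "g \<in> carrier G"
    "\<And>h. h \<in> carrier G \<Longrightarrow> L_dist M d (L_act M G d g F1) F2 \<le> L_dist M d (L_act M G d h F1) F2"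
proof -
  interpret L: Metric_space "L_space M G d" "L_dist M d" by (rule L_metric)
  let ?\<phi> = "\<lambda>g. L_dist M d (L_act M G d g F1) F2"
  have lip: "?\<phi> h \<le> ?\<phi> g + d g h" if "g \<in> carrier G" "h \<in> carrier G" for g h
    using L.triangle[of "L_act M G d h F1" "L_act M G d g F1" F2] that F
      L_dist_act_same[OF that(2,1) F(1)] commute[of g h] L_act_closed by simp
  have "continuous_map mtopology (Met_TC.mtopology) ?\<phi>"
    unfolding metric_continuous_map[OF Met_TC.Metric_space_axioms]
  proof (intro conjI ballI allI impI)
    fix a and e :: real assume "a \<in> carrier G" "0 < e"
    then show "\<exists>\<delta>>0. \<forall>x. x \<in> carrier G \<and> d a x < \<delta> \<longrightarrow> dist (?\<phi> a) (?\<phi> x) < e"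
      using lip commute by (intro exI[of _ e]) (fastforce simp: dist_real_def abs_less_iff)
  qed auto
  then have "continuous_map mtopology euclideanreal ?\<phi>" by simp
  then have "compactin euclideanreal (?\<phi> ` carrier G)"
    using compact image_compactin unfolding compact_space_def topspace_mtopology by blast
  then have "compact (?\<phi> ` carrier G)" by simp
  then show ?thesis using compact_attains_inf[of "?\<phi> ` carrier G"] one_closed that by blast
qed

lemma L_quotient_dist_attained:
  assumes F: "F1 \<in> L_space M G d" "F2 \<in> L_space M G d"
  obtains g where "g \<in> carrier G"
    "L_quotient_dist M G d (L_proj M G d F1) (L_proj M G d F2) = L_dist M d (L_act M G d g F1) F2"
proof -
  obtain g where g: "g \<in> carrier G"
    "\<And>h. h \<in> carrier G \<Longrightarrow> L_dist M d (L_act M G d g F1) F2 \<le> L_dist M d (L_act M G d h F1) F2"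
    using inf_attained[OF F] by blast
  then have "(INF h\<in>carrier G. L_dist M d (L_act M G d h F1) F2) = L_dist M d (L_act M G d g F1) F2"
    by (intro cInf_eq_minimum imageI) auto
  then show ?thesis using that[OF g(1)]
    L_quotient_dist_eq[OF L_proj_in L_proj_in L_proj_mem L_proj_mem, OF F F] by simp
qed

lemma L_quotient_dist_le:
  assumes F: "F1 \<in> L_space M G d" "F2 \<in> L_space M G d" and g: "g \<in> carrier G"
  shows "L_quotient_dist M G d (L_proj M G d F1) (L_proj M G d F2) \<le> L_dist M d (L_act M G d g F1) F2"
proof -
  interpret L: Metric_space "L_space M G d" "L_dist M d" by (rule L_metric)
  have "bdd_below ((\<lambda>g. L_dist M d (L_act M G d g F1) F2) ` carrier G)"
    by (rule bdd_belowI2[where m=0]) simp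
  then show ?thesis
    using cINF_lower[OF _ g]
      L_quotient_dist_eq[OF L_proj_in L_proj_in L_proj_mem L_proj_mem, OF F F] by fastforce
qed

lemma L_quotient_metric: "Metric_space (L_quotient M G d) (L_quotient_dist M G d)"
proof -
  interpret L: Metric_space "L_space M G d" "L_dist M d" by (rule L_metric)
  let ?q = "L_quotient_dist M G d" and ?p = "L_proj M G d" and ?a = "L_act M G d"
  have sym: "?q (?p F1) (?p F2) \<le> ?q (?p F2) (?p F1)"
    if F: "F1 \<in> L_space M G d" "F2 \<in> L_space M G d" for F1 F2
  proof -
    obtain g where g: "g \<in> carrier G" "?q (?p F2) (?p F1) = L_dist M d (?a g F2) F1"
      using L_quotient_dist_attained F by blast
    have "L_dist M d (?a (inv g) F1) F2 = L_dist M d (?a g (?a (inv g) F1)) (?a g F2)"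
      using g F by (simp add: L_dist_act L_act_closed)
    also have "\<dots> = L_dist M d (?a g F2) F1"
      using g F L.commute by (simp add: L_act_mult L_act_one)
    finally show ?thesis using L_quotient_dist_le[OF F, of "inv g"] g by simp
  qed
  show ?thesis
  proof
    fix C1 C2
    show "0 \<le> ?q C1 C2"
      unfolding L_quotient_dist_def by (auto intro!: cINF_greatest)
    show "?q C1 C2 = ?q C2 C1"
    proof (cases "C1 \<in> L_quotient M G d \<and> C2 \<in> L_quotient M G d")
      case True
      then show ?thesis using sym by (metis L_quotient_rep order_antisym)
    qed (auto simp: L_quotient_dist_def)
  next
    fix C1 C2 assume C: "C1 \<in> L_quotient M G d" "C2 \<in> L_quotient M G d"
    obtain F1 where F1: "F1 \<in> L_space M G d" "C1 = ?p F1" using C L_quotient_rep by metis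
    obtain F2 where F2: "F2 \<in> L_space M G d" "C2 = ?p F2" using C L_quotient_rep by metis
    obtain g where g: "g \<in> carrier G" "?q (?p F1) (?p F2) = L_dist M d (?a g F1) F2"
      using L_quotient_dist_attained F1 F2 by blast
    show "?q C1 C2 = 0 \<longleftrightarrow> C1 = C2"
    proof
      assume "?q C1 C2 = 0"
      then have "F2 = ?a g F1" using g F1 F2 L_act_closed by simp
      then have "F2 \<in> C1" using g(1) F1 unfolding L_proj_def orbit_def by blast
      then show "C1 = C2" using L_quotientE C F2 by blast
    next
      assume "C1 = C2"
      then have "F2 \<in> ?p F1" using F1 F2 L_proj_mem by blast
      then obtain h where h: "h \<in> carrier G" "F2 = ?a h F1" unfolding L_proj_def orbit_def by blast
      then have "?q C1 C2 \<le> 0" using L_quotient_dist_le[OF F1(1) F2(1) h(1)] F1 F2 L_act_closed by simp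
      moreover have "0 \<le> ?q C1 C2" using g F1 F2 by simp
      ultimately show "?q C1 C2 = 0" by simp
    qed
  next
    fix C1 C2 C3 assume C: "C1 \<in> L_quotient M G d" "C2 \<in> L_quotient M G d" "C3 \<in> L_quotient M G d"
    obtain F1 where F1: "F1 \<in> L_space M G d" "C1 = ?p F1" using C L_quotient_rep by metis
    obtain F2 where F2: "F2 \<in> L_space M G d" "C2 = ?p F2" using C L_quotient_rep by metis
    obtain F3 where F3: "F3 \<in> L_space M G d" "C3 = ?p F3" using C L_quotient_rep by metis
    obtain g where g: "g \<in> carrier G" "?q (?p F1) (?p F2) = L_dist M d (?a g F1) F2"
      using L_quotient_dist_attained F1 F2 by blast
    obtain h where h: "h \<in> carrier G" "?q (?p F2) (?p F3) = L_dist M d (?a h F2) F3"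
      using L_quotient_dist_attained F2 F3 by blast
    have "?q C1 C3 \<le> L_dist M d (?a (h \<otimes> g) F1) F3"
      using L_quotient_dist_le[of F1 F3 "h \<otimes> g"] F1 F3 g h by simp
    also have "\<dots> \<le> L_dist M d (?a h (?a g F1)) (?a h F2) + L_dist M d (?a h F2) F3"
      using L.triangle g h F1 F2 F3 L_act_closed by (simp add: L_act_mult)
    also have "\<dots> = ?q C1 C2 + ?q C2 C3"
      using g h F1 F2 F3 by (simp add: L_dist_act L_act_closed)
    finally show "?q C1 C3 \<le> ?q C1 C2 + ?q C2 C3" .
  qed
qed

end
end

theory Submission
  imports Defs
begin

text \<open>
  The proof rests on one feature of the action of \<open>G\<close> on \<open>L(G)\<close>: integrating the right invariant
  distance gives \<open>d(g.f, h.f) = d(g, h)\<close>, so every orbit is an isometric copy of \<open>G\<close>, with a scale that does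
  not depend on the orbit. Two points of a fibre that are close therefore differ by an element of \<open>G\<close> close
  to \<open>1\<close>, and the small elements of \<open>G\<close> are separated from the others by a gap, as \<open>G\<close> is compact and
  totally disconnected.

  Suppose two paths in \<open>L(G)\<close> run over nearby paths in the quotient. The group element that compares
  them changes by little in a short time, so it cannot cross the gap: if the paths start
  close to each other, they stay close. This is \<open>coarse_path_stability\<close>, stated for paths that may make
  small jumps. For a common base path it gives unique path lifting. It also gives
  existence: lifts with small jumps are constructed by hand (\<open>coarse_lift_exists\<close>), they are uniformly
  Cauchy by stability, and they converge fibrewise because \<open>G\<close> is complete (\<open>path_lifting\<close>). Applied to
  the paths \<open>u \<mapsto> H(x, u)\<close> for varying \<open>x\<close>, stability shows that the lifts of single paths fit together
  continuously, over an arbitrary space \<open>X\<close> (\<open>homotopy_lift_exists\<close>).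

  Local cross-sections fail to exist because of monodromy. Let \<open>\<phi>\<close> be an injective measurable real function on \<open>\<Omega>\<close>; its distribution has no
  atoms. Replacing \<open>f\<close> by \<open>g f\<close> on \<open>{\<phi> \<le> u}\<close> gives a path from \<open>f\<close> to \<open>g f\<close>, within the ball of radius
  \<open>d(1, g)\<close> around \<open>f\<close> (\<open>short_path_to_translate\<close>). For \<open>g \<noteq> 1\<close> close to \<open>1\<close> it projects to a loop in any
  prescribed neighbourhood, and the loop has a lift that is not closed; a section on that neighbourhood would
  provide a closed lift with the same start (\<open>no_local_cross_section\<close>).
\<close>

section \<open>Uniform continuity and the unit interval\<close>

lemma compact_continuous_imp_uniform:
  assumes M: "Metric_space M d" and M': "Metric_space M' d'"
    and compact: "compact_space (Metric_space.mtopology M d)"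
    and cont: "continuous_map (Metric_space.mtopology M d) (Metric_space.mtopology M' d') f"
    and e: "e > (0::real)"
  obtains \<delta> where "\<delta> > 0" "\<And>x y. x \<in> M \<Longrightarrow> y \<in> M \<Longrightarrow> d x y < \<delta> \<Longrightarrow> d' (f x) (f y) < e"
proof -
  have "mtopology_of (metric (M, d)) = Metric_space.mtopology M d"
    "mtopology_of (metric (M', d')) = Metric_space.mtopology M' d'"
    using M M' by (simp_all add: mtopology_of_def Metric_space.mspace_metric Metric_space.mdist_metric)
  then have "uniformly_continuous_map (metric (M, d)) (metric (M', d')) f"
    using compact cont by (intro continuous_imp_uniformly_continuous_map) simp
  then have "\<exists>\<delta>>0. \<forall>x\<in>M. \<forall>y\<in>M. d y x < \<delta> \<longrightarrow> d' (f y) (f x) < e"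
    using e M M' by (simp add: uniformly_continuous_map_def Metric_space.mspace_metric Metric_space.mdist_metric)
  then show thesis using that by blast
qed

text \<open>
  Connectedness of the unit interval in the form used below: a property that passes between points
  at distance less than a fixed \<open>\<eta>\<close> spreads from \<open>0\<close> to the whole interval.
\<close>

lemma unit_interval_chain_induct:
  fixes P :: "real \<Rightarrow> bool"
  assumes 0: "P 0" and \<eta>: "\<eta> > 0"
    and step: "\<And>u v. u \<in> {0..1} \<Longrightarrow> v \<in> {0..1} \<Longrightarrow> \<bar>u - v\<bar> < \<eta> \<Longrightarrow> P u \<Longrightarrow> P v"
    and u: "u \<in> {0..1}"
  shows "P u"
proof -
  have "P v" if "v \<in> {0..1}" "v \<le> real k * (\<eta> / 2)" for k v
    using that
  proof (induction k arbitrary: v)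
    case 0
    then show ?case using assms(1) by (auto simp: antisym)
  next
    case (Suc k)
    define w where "w = max 0 (v - \<eta> / 2)"
    have "w \<in> {0..1}" "w \<le> real k * (\<eta> / 2)" "\<bar>w - v\<bar> < \<eta>"
      using Suc.prems \<eta> by (auto simp: w_def algebra_simps max_def)
    then show ?case using Suc.IH step Suc.prems(1) by blast
  qed
  moreover obtain k where "u \<le> real k * (\<eta> / 2)"
    using \<eta> real_arch_simple[of "u / (\<eta> / 2)"] by (auto simp: field_simps)
  ultimately show ?thesis using u by blast
qed

lemma (in Metric_space) continuous_path_uniform:
  assumes cont: "continuous_map (top_of_set {0..1::real}) mtopology \<gamma>" and \<epsilon>: "\<epsilon> > 0"
  shows "\<exists>\<eta>>0. \<forall>u\<in>{0..1}. \<forall>v\<in>{0..1}. \<bar>u - v\<bar> < \<eta> \<longrightarrow> d (\<gamma> u) (\<gamma> v) < \<epsilon>"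
proof -
  interpret I: Submetric UNIV "dist :: real \<Rightarrow> real \<Rightarrow> real" "{0..1}" by unfold_locales auto
  have top: "I.sub.mtopology = top_of_set {0..1}" by (simp add: I.mtopology_submetric)
  have "compact_space I.sub.mtopology" unfolding top by (simp add: compact_space_subtopology)
  then show ?thesis
    using compact_continuous_imp_uniform[OF I.sub.Metric_space_axioms Metric_space_axioms _ _ \<epsilon>] cont
    unfolding top dist_real_def by metis
qed

lemma continuous_slice:
  assumes "continuous_map (prod_topology X (top_of_set {0..1})) Y H" "x \<in> topspace X"
  shows "continuous_map (top_of_set {0..1}) Y (\<lambda>u. H (x, u))"
proof -
  have "continuous_map (top_of_set {0..1}) (prod_topology X (top_of_set {0..1})) (\<lambda>u. (x, u))"
    using assms(2) by (intro continuous_map_pairedI) auto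
  then show ?thesis using continuous_map_compose[OF _ assms(1)] by (simp add: o_def)
qed

section \<open>Isometric actions of profinite groups\<close>

text \<open>
  The abstract situation behind the projection \<open>L(G) \<rightarrow> L(G)/G\<close>. The decisive assumption is
  \<open>orbit_isometry\<close>: every orbit map \<open>g \<mapsto> g x\<close> is an isometric embedding of \<open>G\<close>. It makes the action
  free, uniformly over the whole total space, and turns each fibre into an isometric copy of \<open>G\<close>.
  Limits of approximate lifts are taken inside the fibres, which are complete because \<open>G\<close> is compact.
\<close>

locale profinite_isometric_action =
  group G + Gm: Metric_space "carrier G" d + E: Metric_space E dE + B: Metric_space B dB
  for G :: "('g, 'm) monoid_scheme" (structure) and d :: "'g \<Rightarrow> 'g \<Rightarrow> real"
    and E :: "'e set" and dE :: "'e \<Rightarrow> 'e \<Rightarrow> real" and B :: "'b set" and dB :: "'b \<Rightarrow> 'b \<Rightarrow> real" +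
  fixes act :: "'g \<Rightarrow> 'e \<Rightarrow> 'e" and p :: "'e \<Rightarrow> 'b"
  assumes compact: "compact_space Gm.mtopology"
    and totally_disconnected: "\<And>C. connectedin Gm.mtopology C \<Longrightarrow> \<exists>a. C \<subseteq> {a}"
    and act_closed: "\<And>g x. g \<in> carrier G \<Longrightarrow> x \<in> E \<Longrightarrow> act g x \<in> E"
    and act_one: "\<And>x. x \<in> E \<Longrightarrow> act \<one> x = x"
    and act_isometry: "\<And>g x y. g \<in> carrier G \<Longrightarrow> x \<in> E \<Longrightarrow> y \<in> E \<Longrightarrow> dE (act g x) (act g y) = dE x y"
    and orbit_isometry: "\<And>g h x. g \<in> carrier G \<Longrightarrow> h \<in> carrier G \<Longrightarrow> x \<in> E \<Longrightarrow> dE (act g x) (act h x) = d g h"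
    and p_in: "\<And>x. x \<in> E \<Longrightarrow> p x \<in> B"
    and p_surj: "\<And>b. b \<in> B \<Longrightarrow> \<exists>x\<in>E. p x = b"
    and p_act: "\<And>g x. g \<in> carrier G \<Longrightarrow> x \<in> E \<Longrightarrow> p (act g x) = p x"
    and p_contract: "\<And>x y. x \<in> E \<Longrightarrow> y \<in> E \<Longrightarrow> dB (p x) (p y) \<le> dE x y"
    and dB_attained: "\<And>x y. x \<in> E \<Longrightarrow> y \<in> E \<Longrightarrow> \<exists>g\<in>carrier G. dB (p x) (p y) = dE (act g x) y"
begin

lemma continuous_p: "continuous_map E.mtopology B.mtopology p"
  unfolding E.metric_continuous_map[OF B.Metric_space_axioms]
proof (intro conjI ballI allI impI)
  fix a and e :: real assume "a \<in> E" "0 < e"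
  then show "\<exists>\<delta>>0. \<forall>x. x \<in> E \<and> dE a x < \<delta> \<longrightarrow> dB (p a) (p x) < e"
    using p_contract by (intro exI[of _ e]) (auto intro: le_less_trans)
qed (use p_in in auto)

lemma same_fibre:
  assumes "x \<in> E" "y \<in> E" "p x = p y"
  obtains g where "g \<in> carrier G" "act g x = y"
proof -
  obtain g where g: "g \<in> carrier G" "dB (p x) (p y) = dE (act g x) y"
    using dB_attained assms by blast
  then have "dE (act g x) y = 0" using assms p_in by simp
  then show thesis using g assms act_closed that by simp
qed

lemma nearby_point_in_fibre:
  assumes "x \<in> E" "b \<in> B" "dB (p x) b < r"
  shows "\<exists>y\<in>E. p y = b \<and> dE x y < r"
proof -
  obtain y0 where y0: "y0 \<in> E" "p y0 = b" using p_surj assms by blast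
  then obtain g where "g \<in> carrier G" "dB (p y0) (p x) = dE (act g y0) x"
    using dB_attained assms by blast
  then show ?thesis
    using y0 assms act_closed p_act B.commute E.commute by (intro bexI[of _ "act g y0"]) auto
qed

text \<open>
  The only place where total disconnectedness enters. Components and quasi-components of a compact
  Hausdorff space agree, so \<open>\<one>\<close> has a clopen neighbourhood \<open>W\<close> inside any ball; the indicator
  function of \<open>W\<close> is then uniformly continuous, which forces a gap between \<open>W\<close> and its complement.
\<close>

lemma separated_neighbourhood:
  assumes "\<epsilon> > 0"
  obtains W \<delta> where "\<one> \<in> W" "W \<subseteq> carrier G" "\<And>g. g \<in> W \<Longrightarrow> d \<one> g < \<epsilon>"
    "\<delta> > 0" "\<And>g h. g \<in> W \<Longrightarrow> h \<in> carrier G \<Longrightarrow> d g h < \<delta> \<Longrightarrow> h \<in> W"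
proof -
  have "separated_between Gm.mtopology {\<one>} (carrier G - Gm.mball \<one> \<epsilon>)"
  proof (rule cut_wire_fence_theorem_gen[OF compact])
    show "closedin Gm.mtopology (carrier G - Gm.mball \<one> \<epsilon>)"
      using Gm.openin_mball openin_closedin_eq by (metis Gm.topspace_mtopology)
    show "disjnt C {\<one>} \<or> disjnt C (carrier G - Gm.mball \<one> \<epsilon>)" if "connectedin Gm.mtopology C" for C
    proof -
      obtain a where "C \<subseteq> {a}" using totally_disconnected[OF \<open>connectedin Gm.mtopology C\<close>] by blast
      then show ?thesis using assms by (cases "a = \<one>") (auto simp: disjnt_iff)
    qed
  qed (auto simp: Gm.Hausdorff_space_mtopology)
  then obtain W where W: "closedin Gm.mtopology W" "openin Gm.mtopology W" "\<one> \<in> W"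
    "carrier G - Gm.mball \<one> \<epsilon> \<subseteq> carrier G - W"
    unfolding separated_between by auto
  have W_sub: "W \<subseteq> carrier G" using openin_subset[OF W(2)] by simp
  have compl: "openin Gm.mtopology (carrier G - W)" using W(1) by (simp add: closedin_def)
  let ?\<chi> = "indicator W :: 'g \<Rightarrow> real"
  have "continuous_map Gm.mtopology Met_TC.mtopology ?\<chi>"
    unfolding Met_TC.continuous_map_to_metric
  proof (intro ballI allI impI)
    fix x and e :: real assume x: "x \<in> topspace Gm.mtopology" and e: "e > 0"
    show "\<exists>U. openin Gm.mtopology U \<and> x \<in> U \<and> (\<forall>y\<in>U. ?\<chi> y \<in> Met_TC.mball (?\<chi> x) e)"
    proof (cases "x \<in> W")
      case True
      then show ?thesis using W e by (intro exI[of _ W]) auto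
    next
      case False
      then show ?thesis using compl x e by (intro exI[of _ "carrier G - W"]) auto
    qed
  qed
  then obtain \<delta> where \<delta>: "\<delta> > 0"
    "\<And>x y. x \<in> carrier G \<Longrightarrow> y \<in> carrier G \<Longrightarrow> d x y < \<delta> \<Longrightarrow> dist (?\<chi> x) (?\<chi> y) < 1"
    using compact_continuous_imp_uniform[OF Gm.Metric_space_axioms Met_TC.Metric_space_axioms compact _ zero_less_one]
    by blast
  show thesis
  proof
    show "h \<in> W" if "g \<in> W" "h \<in> carrier G" "d g h < \<delta>" for g h
      using \<delta>(2)[of g h] W_sub that by (cases "h \<in> W") auto
    show "d \<one> g < \<epsilon>" if "g \<in> W" for g using that W(4) W_sub by auto
  qed (use W W_sub \<delta> in auto)
qed

text \<open>
  Paths that may jump, but by less than \<open>\<delta>\<close>. They exist over every path of the base, whereas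
  genuine lifts can only be reached as their limits: no open set of the base need carry
  a section to start from.
\<close>

definition coarse_path :: "real \<Rightarrow> (real \<Rightarrow> 'e) \<Rightarrow> bool" where
  "coarse_path \<delta> \<kappa> \<longleftrightarrow> \<kappa> \<in> {0..1} \<rightarrow> E \<and>
     (\<exists>\<eta>>0. \<forall>u\<in>{0..1}. \<forall>v\<in>{0..1}. \<bar>u - v\<bar> < \<eta> \<longrightarrow> dE (\<kappa> u) (\<kappa> v) < \<delta>)"

text \<open>
  The engine of the whole argument. Two coarse paths over nearby paths of the base are compared at
  each time by some \<open>g\<close> with \<open>g \<kappa>(u)\<close> close to \<open>\<kappa>'(u)\<close>. Because orbit maps are isometric, such \<open>g\<close>
  moves by at most \<open>4\<delta>\<close> when \<open>u\<close> moves a little; so it cannot jump across the gap around the clopen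
  neighbourhood \<open>W\<close> of \<open>\<one>\<close> and stays in \<open>W\<close>, hence near \<open>\<one>\<close>, for all times. Uniqueness of lifts,
  convergence of coarse lifts and continuity in a parameter are all instances.
\<close>

lemma coarse_path_stability:
  assumes \<epsilon>: "\<epsilon> > 0"
  obtains \<delta> where "\<delta> > 0"
    "\<And>\<kappa> \<kappa>' u. coarse_path \<delta> \<kappa> \<Longrightarrow> coarse_path \<delta> \<kappa>' \<Longrightarrow> dE (\<kappa> 0) (\<kappa>' 0) < \<delta> \<Longrightarrow>
       (\<And>v. v \<in> {0..1} \<Longrightarrow> dB (p (\<kappa> v)) (p (\<kappa>' v)) < \<delta>) \<Longrightarrow> u \<in> {0..1} \<Longrightarrow> dE (\<kappa> u) (\<kappa>' u) < \<epsilon>"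
proof -
  obtain W gap where W: "\<one> \<in> W" "W \<subseteq> carrier G" "\<And>g. g \<in> W \<Longrightarrow> d \<one> g < \<epsilon> / 2" "gap > 0"
    "\<And>g h. g \<in> W \<Longrightarrow> h \<in> carrier G \<Longrightarrow> d g h < gap \<Longrightarrow> h \<in> W"
    using separated_neighbourhood[of "\<epsilon> / 2"] \<epsilon> by (metis half_gt_zero)
  \<comment> \<open>A quarter of the gap, since four errors of size \<open>\<delta>\<close> add up in the chain of triangle inequalities.\<close>
  define \<delta> where "\<delta> = min (gap / 4) (\<epsilon> / 2)"
  have \<delta>: "\<delta> > 0" "4 * \<delta> \<le> gap" "2 * \<delta> \<le> \<epsilon>" using W(4) \<epsilon> by (auto simp: \<delta>_def)
  show thesis
  proof (rule that[OF \<delta>(1)])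
    fix \<kappa> \<kappa>' and u :: real
    assume \<kappa>: "coarse_path \<delta> \<kappa>" and \<kappa>': "coarse_path \<delta> \<kappa>'" and start: "dE (\<kappa> 0) (\<kappa>' 0) < \<delta>"
      and near: "\<And>v. v \<in> {0..1} \<Longrightarrow> dB (p (\<kappa> v)) (p (\<kappa>' v)) < \<delta>" and u: "u \<in> {0..1}"
    have in_E: "\<kappa> v \<in> E" "\<kappa>' v \<in> E" if "v \<in> {0..1}" for v
      using that \<kappa> \<kappa>' by (auto simp: coarse_path_def)
    obtain \<eta> where \<eta>: "\<eta> > 0" "\<And>u v. u \<in> {0..1} \<Longrightarrow> v \<in> {0..1} \<Longrightarrow> \<bar>u - v\<bar> < \<eta> \<Longrightarrow> dE (\<kappa> u) (\<kappa> v) < \<delta>"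
      using \<kappa> unfolding coarse_path_def by blast
    obtain \<eta>' where \<eta>': "\<eta>' > 0" "\<And>u v. u \<in> {0..1} \<Longrightarrow> v \<in> {0..1} \<Longrightarrow> \<bar>u - v\<bar> < \<eta>' \<Longrightarrow> dE (\<kappa>' u) (\<kappa>' v) < \<delta>"
      using \<kappa>' unfolding coarse_path_def by blast
    have "\<exists>g\<in>W. dE (act g (\<kappa> u)) (\<kappa>' u) < \<delta>"
    proof (rule unit_interval_chain_induct[where P = "\<lambda>u. \<exists>g\<in>W. dE (act g (\<kappa> u)) (\<kappa>' u) < \<delta>" and \<eta> = "min \<eta> \<eta>'"])
      show "\<exists>g\<in>W. dE (act g (\<kappa> 0)) (\<kappa>' 0) < \<delta>"
        using W(1) start in_E act_one by (intro bexI[of _ \<one>]) auto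
    next
      fix u v :: real
      assume uv: "u \<in> {0..1}" "v \<in> {0..1}" "\<bar>u - v\<bar> < min \<eta> \<eta>'"
        and "\<exists>g\<in>W. dE (act g (\<kappa> u)) (\<kappa>' u) < \<delta>"
      then obtain g where g: "g \<in> W" "dE (act g (\<kappa> u)) (\<kappa>' u) < \<delta>" by blast
      obtain h where h: "h \<in> carrier G" "dE (act h (\<kappa> v)) (\<kappa>' v) < \<delta>"
        using dB_attained[OF in_E, of v v] near[of v] uv by auto
      have gc: "g \<in> carrier G" using g W by blast
      have "d g h = dE (act g (\<kappa> u)) (act h (\<kappa> u))" using gc h in_E uv orbit_isometry by simp
      also have "\<dots> \<le> dE (act g (\<kappa> u)) (\<kappa>' u) + dE (\<kappa>' u) (act h (\<kappa> u))"
        using gc h in_E uv act_closed by (intro E.triangle) auto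
      also have "dE (\<kappa>' u) (act h (\<kappa> u)) \<le> dE (\<kappa>' u) (\<kappa>' v) + dE (\<kappa>' v) (act h (\<kappa> u))"
        using gc h in_E uv act_closed by (intro E.triangle) auto
      also have "dE (\<kappa>' v) (act h (\<kappa> u)) \<le> dE (\<kappa>' v) (act h (\<kappa> v)) + dE (act h (\<kappa> v)) (act h (\<kappa> u))"
        using gc h in_E uv act_closed by (intro E.triangle) auto
      also have "dE (act h (\<kappa> v)) (act h (\<kappa> u)) = dE (\<kappa> u) (\<kappa> v)"
        using h in_E uv act_isometry E.commute by simp
      finally have "d g h < 4 * \<delta>"
        using g h \<eta>(2)[of u v] \<eta>'(2)[of u v] uv E.commute[of "\<kappa>' v" "act h (\<kappa> v)"] by simp
      then have "h \<in> W" using W(5)[OF g(1) h(1)] \<delta> by simp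
      then show "\<exists>g\<in>W. dE (act g (\<kappa> v)) (\<kappa>' v) < \<delta>" using h by blast
    qed (use \<eta> \<eta>' u in auto)
    then obtain g where g: "g \<in> W" "dE (act g (\<kappa> u)) (\<kappa>' u) < \<delta>" by blast
    have gc: "g \<in> carrier G" using g W by blast
    have "dE (\<kappa> u) (\<kappa>' u) \<le> dE (act \<one> (\<kappa> u)) (act g (\<kappa> u)) + dE (act g (\<kappa> u)) (\<kappa>' u)"
      using E.triangle[of "\<kappa> u" "act g (\<kappa> u)" "\<kappa>' u"] in_E[OF u] gc act_closed act_one by simp
    also have "dE (act \<one> (\<kappa> u)) (act g (\<kappa> u)) = d \<one> g" using orbit_isometry gc in_E[OF u] by simp
    finally show "dE (\<kappa> u) (\<kappa>' u) < \<epsilon>" using g W(3)[OF g(1)] \<delta>(3) by simp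
  qed
qed

lemma continuous_path_imp_coarse:
  assumes "continuous_map (top_of_set {0..1}) E.mtopology \<kappa>" "\<delta> > 0"
  shows "coarse_path \<delta> \<kappa>"
  using E.continuous_path_uniform[OF assms] continuous_map_funspace[OF assms(1)]
  unfolding coarse_path_def by simp

lemma unique_path_lifting:
  assumes \<kappa>: "\<And>\<delta>. \<delta> > 0 \<Longrightarrow> coarse_path \<delta> \<kappa>" "\<And>\<delta>. \<delta> > 0 \<Longrightarrow> coarse_path \<delta> \<kappa>'"
    and start: "\<kappa> 0 = \<kappa>' 0" and p: "\<And>v. v \<in> {0..1} \<Longrightarrow> p (\<kappa> v) = p (\<kappa>' v)" and u: "u \<in> {0..1}"
  shows "\<kappa> u = \<kappa>' u"
proof -
  have in_E: "\<kappa> v \<in> E" "\<kappa>' v \<in> E" if "v \<in> {0..1}" for v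
    using that \<kappa>[of 1] by (auto simp: coarse_path_def)
  have "dE (\<kappa> u) (\<kappa>' u) < \<epsilon>" if "\<epsilon> > 0" for \<epsilon>
  proof -
    obtain \<delta> where "\<delta> > 0" "\<And>\<kappa> \<kappa>' u. coarse_path \<delta> \<kappa> \<Longrightarrow> coarse_path \<delta> \<kappa>' \<Longrightarrow> dE (\<kappa> 0) (\<kappa>' 0) < \<delta> \<Longrightarrow>
       (\<And>v. v \<in> {0..1} \<Longrightarrow> dB (p (\<kappa> v)) (p (\<kappa>' v)) < \<delta>) \<Longrightarrow> u \<in> {0..1} \<Longrightarrow> dE (\<kappa> u) (\<kappa>' u) < \<epsilon>"
      using coarse_path_stability[OF \<open>\<epsilon> > 0\<close>] by blast
    then show ?thesis using \<kappa> start p u in_E p_in by simp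
  qed
  then have "dE (\<kappa> u) (\<kappa>' u) = 0" using E.nonneg by (metis less_irrefl order_le_less)
  then show ?thesis using in_E[OF u] by simp
qed

text \<open>
  Along a fine grid one moves from each fibre to a nearby point of the next one; intermediate times
  borrow a point close to the one chosen at the grid point to their left.
\<close>

lemma coarse_lift_exists:
  assumes \<gamma>: "\<gamma> \<in> {0..1} \<rightarrow> B" and \<eta>: "\<eta> > 0"
    "\<And>u v. u \<in> {0..1} \<Longrightarrow> v \<in> {0..1} \<Longrightarrow> \<bar>u - v\<bar> < \<eta> \<Longrightarrow> dB (\<gamma> u) (\<gamma> v) < \<delta> / 3"
    and x: "x \<in> E" "p x = \<gamma> 0"
  obtains \<kappa> where "coarse_path \<delta> \<kappa>" "\<And>u. u \<in> {0..1} \<Longrightarrow> p (\<kappa> u) = \<gamma> u" "dE (\<kappa> 0) x < \<delta>"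
proof -
  obtain m :: nat where m: "m > 0" "1 / m < \<eta>"
    using \<eta>(1) by (metis inverse_eq_divide ex_inverse_of_nat_less)
  \<comment> \<open>Truncating at \<open>1\<close> lets the recursion run over all natural numbers while staying in the interval.\<close>
  define grid where "grid i = min 1 (real i / m)" for i
  have grid: "grid i \<in> {0..1}" "\<bar>grid i - grid (Suc i)\<bar> < \<eta>" for i
  proof -
    show "grid i \<in> {0..1}" by (simp add: grid_def)
    have "real (Suc i) / m = real i / m + 1 / m" by (simp add: add_divide_distrib)
    moreover have "0 \<le> 1 / real m" by simp
    ultimately have "\<bar>grid i - grid (Suc i)\<bar> \<le> 1 / m" unfolding grid_def by linarith
    then show "\<bar>grid i - grid (Suc i)\<bar> < \<eta>" using m(2) by simp
  qed
  have "\<exists>F. \<forall>i. (F i \<in> E \<and> p (F i) = \<gamma> (grid i) \<and> (i = 0 \<longrightarrow> F i = x)) \<and> dE (F i) (F (Suc i)) < \<delta> / 3"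
  proof (rule dependent_nat_choice)
    show "\<exists>y. y \<in> E \<and> p y = \<gamma> (grid 0) \<and> (0 = (0::nat) \<longrightarrow> y = x)" using x by (auto simp: grid_def)
    fix y i assume y: "y \<in> E \<and> p y = \<gamma> (grid i) \<and> (i = 0 \<longrightarrow> y = x)"
    then have "dB (p y) (\<gamma> (grid (Suc i))) < \<delta> / 3" using \<eta>(2)[OF grid(1) grid(1) grid(2)] by simp
    then show "\<exists>z. (z \<in> E \<and> p z = \<gamma> (grid (Suc i)) \<and> (Suc i = 0 \<longrightarrow> z = x)) \<and> dE y z < \<delta> / 3"
      using nearby_point_in_fibre[of y "\<gamma> (grid (Suc i))" "\<delta> / 3"] y \<gamma> grid(1)[of "Suc i"] by blast
  qed
  then obtain F where F: "\<And>i. F i \<in> E" "\<And>i. p (F i) = \<gamma> (grid i)" "F 0 = x"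
    "\<And>i. dE (F i) (F (Suc i)) < \<delta> / 3" by metis
  have \<delta>: "\<delta> > 0" using F(4)[of 0] E.nonneg[of "F 0" "F (Suc 0)"] by linarith
  define idx where "idx u = nat \<lfloor>u * m\<rfloor>" for u :: real
  have idx: "real (idx u) \<le> u * m" "u * m < real (idx u) + 1" if "u \<in> {0..1}" for u
  proof -
    have "0 \<le> u * m" using that by simp
    then show "real (idx u) \<le> u * m" "u * m < real (idx u) + 1" unfolding idx_def by linarith+
  qed
  have near: "\<bar>grid (idx u) - u\<bar> < \<eta>" if u: "u \<in> {0..1}" for u
  proof -
    have "real (idx u) \<le> m" using idx(1)[OF u] u mult_right_mono[of u 1 "real m"] by simp
    then have "grid (idx u) = real (idx u) / m" using m(1) by (simp add: grid_def)
    moreover have "real (idx u) / m \<le> u" "u < real (idx u) / m + 1 / m"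
      using idx[OF u] m(1) by (auto simp: field_simps)
    ultimately show ?thesis using m(2) by linarith
  qed
  have "\<exists>y. y \<in> E \<and> p y = \<gamma> u \<and> dE (F (idx u)) y < \<delta> / 3" if u: "u \<in> {0..1}" for u
    using nearby_point_in_fibre[of "F (idx u)" "\<gamma> u" "\<delta> / 3"] F(1,2) \<eta>(2)[OF grid(1) u near[OF u]] \<gamma> u
    by fastforce
  then obtain \<kappa> where \<kappa>: "\<And>u. u \<in> {0..1} \<Longrightarrow> \<kappa> u \<in> E \<and> p (\<kappa> u) = \<gamma> u \<and> dE (F (idx u)) (\<kappa> u) < \<delta> / 3"
    by metis
  have "dE (\<kappa> u) (\<kappa> v) < \<delta>" if uv: "u \<in> {0..1}" "v \<in> {0..1}" and close: "\<bar>u - v\<bar> < 1 / m" for u v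
  proof -
    have "\<bar>u * m - v * m\<bar> < 1"
      using close m(1) by (simp add: abs_less_iff field_simps)
    then have "idx v = idx u \<or> idx v = Suc (idx u) \<or> idx u = Suc (idx v)"
      using idx[OF uv(1)] idx[OF uv(2)] by linarith
    then have "dE (F (idx u)) (F (idx v)) < \<delta> / 3"
      using F(1) F(4)[of "idx u"] F(4)[of "idx v"] \<delta> E.commute[of "F (idx u)" "F (idx v)"]
      by (elim disjE) simp_all
    moreover have "dE (\<kappa> u) (\<kappa> v) \<le> dE (\<kappa> u) (F (idx u)) + dE (F (idx u)) (\<kappa> v)"
      "dE (F (idx u)) (\<kappa> v) \<le> dE (F (idx u)) (F (idx v)) + dE (F (idx v)) (\<kappa> v)"
      using \<kappa> uv F(1) by (auto intro!: E.triangle)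
    ultimately show ?thesis using \<kappa>[OF uv(1)] \<kappa>[OF uv(2)] E.commute[of "\<kappa> u" "F (idx u)"] by linarith
  qed
  then have "coarse_path \<delta> \<kappa>"
    unfolding coarse_path_def using \<kappa> m(1) by (intro conjI exI[of _ "1 / real m"]) auto
  moreover have "dE (\<kappa> 0) x < \<delta>"
    using \<kappa>[of 0] F(3) \<delta> E.commute[of x "\<kappa> 0"] by (simp add: idx_def)
  ultimately show thesis using that \<kappa> by blast
qed

text \<open>
  Coarse lifts with jumps tending to \<open>0\<close> are uniformly Cauchy by stability. In each fibre
  they converge, the fibre being an isometric image of the compact group, and a uniform limit of ever
  less coarse paths has no jumps left.
\<close>

lemma path_lifting:
  assumes \<gamma>: "\<gamma> \<in> {0..1} \<rightarrow> B"
    and unif: "\<And>\<epsilon>. \<epsilon> > 0 \<Longrightarrow> \<exists>\<eta>>0. \<forall>u\<in>{0..1}. \<forall>v\<in>{0..1}. \<bar>u - v\<bar> < \<eta> \<longrightarrow> dB (\<gamma> u) (\<gamma> v) < \<epsilon>"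
    and x: "x \<in> E" "p x = \<gamma> 0"
  obtains \<kappa> where "\<And>\<delta>. \<delta> > 0 \<Longrightarrow> coarse_path \<delta> \<kappa>" "\<And>u. u \<in> {0..1} \<Longrightarrow> p (\<kappa> u) = \<gamma> u" "\<kappa> 0 = x"
proof -
  have "\<exists>\<kappa>. coarse_path \<delta> \<kappa> \<and> (\<forall>u\<in>{0..1}. p (\<kappa> u) = \<gamma> u) \<and> dE (\<kappa> 0) x < \<delta>" if "\<delta> > 0" for \<delta>
    using unif[of "\<delta> / 3"] coarse_lift_exists[OF \<gamma> _ _ x, of _ \<delta>] that by (metis zero_less_divide_iff zero_less_numeral)
  then obtain K where K: "\<And>\<delta>. \<delta> > 0 \<Longrightarrow> coarse_path \<delta> (K \<delta>)"
    "\<And>\<delta> u. \<delta> > 0 \<Longrightarrow> u \<in> {0..1} \<Longrightarrow> p (K \<delta> u) = \<gamma> u" "\<And>\<delta>. \<delta> > 0 \<Longrightarrow> dE (K \<delta> 0) x < \<delta>"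
    by metis
  define k where "k n = K (1 / real (Suc n))" for n
  have k_in: "k n u \<in> E" "p (k n u) = \<gamma> u" if "u \<in> {0..1}" for n u
    using that K(1,2)[of "1 / real (Suc n)"] by (auto simp: coarse_path_def k_def)
  have coarse_mono: "coarse_path \<delta>' \<kappa>" if "coarse_path \<delta> \<kappa>" "\<delta> \<le> \<delta>'" for \<delta> \<delta>' \<kappa>
    using that unfolding coarse_path_def by (meson order_less_le_trans)
  have small: "\<exists>N. \<forall>n\<ge>N. 1 / real (Suc n) < \<delta>" if "\<delta> > 0" for \<delta>
  proof -
    obtain N where "1 / real (Suc N) < \<delta>" using nat_approx_posE[OF \<open>\<delta> > 0\<close>] by blast
    moreover have "1 / real (Suc n) \<le> 1 / real (Suc N)" if "N \<le> n" for n
      using that by (intro divide_left_mono) auto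
    ultimately show ?thesis by (intro exI[of _ N]) (auto intro: le_less_trans)
  qed
  have Cauchy: "\<exists>N. \<forall>n\<ge>N. \<forall>m\<ge>N. \<forall>u\<in>{0..1}. dE (k n u) (k m u) < \<epsilon>" if \<epsilon>: "\<epsilon> > 0" for \<epsilon>
  proof -
    obtain \<delta> where \<delta>: "\<delta> > 0" "\<And>\<kappa> \<kappa>' u. coarse_path \<delta> \<kappa> \<Longrightarrow> coarse_path \<delta> \<kappa>' \<Longrightarrow> dE (\<kappa> 0) (\<kappa>' 0) < \<delta> \<Longrightarrow>
       (\<And>v. v \<in> {0..1} \<Longrightarrow> dB (p (\<kappa> v)) (p (\<kappa>' v)) < \<delta>) \<Longrightarrow> u \<in> {0..1} \<Longrightarrow> dE (\<kappa> u) (\<kappa>' u) < \<epsilon>"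
      using coarse_path_stability[OF \<epsilon>] by blast
    obtain N where N: "\<And>n. n \<ge> N \<Longrightarrow> 1 / real (Suc n) < \<delta> / 2" using small[of "\<delta> / 2"] \<delta>(1) by auto
    have "dE (k n u) (k m u) < \<epsilon>" if "n \<ge> N" "m \<ge> N" "u \<in> {0..1}" for n m u
    proof (rule \<delta>(2))
      show "coarse_path \<delta> (k n)" "coarse_path \<delta> (k m)"
        using coarse_mono[OF K(1)] N that(1,2) \<delta>(1) unfolding k_def by (fastforce intro: less_imp_le)+
      have "dE (k n 0) (k m 0) \<le> dE (k n 0) x + dE (k m 0) x"
        using E.triangle[of "k n 0" x "k m 0"] E.commute[of x] k_in x by simp
      then show "dE (k n 0) (k m 0) < \<delta>"
        using K(3)[of "1 / real (Suc n)"] K(3)[of "1 / real (Suc m)"] N[OF that(1)] N[OF that(2)]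
        by (simp add: k_def)
      show "dB (p (k n v)) (p (k m v)) < \<delta>" if "v \<in> {0..1}" for v
        using k_in[OF that] \<delta>(1) p_in[OF k_in(1)[OF that, of n]] by simp
    qed (use that in auto)
    then show ?thesis by blast
  qed
  have "\<exists>y\<in>E. p y = \<gamma> u \<and> (\<forall>\<epsilon>>0. \<exists>N. \<forall>n\<ge>N. dE (k n u) y < \<epsilon>)" if u: "u \<in> {0..1}" for u
  proof -
    \<comment> \<open>A base point of the fibre transports the Cauchy sequence to the complete space \<open>G\<close>.\<close>
    obtain y0 where y0: "y0 \<in> E" "p y0 = \<gamma> u" using p_surj \<gamma> u by blast
    have "\<exists>g. g \<in> carrier G \<and> act g y0 = k n u" for n
      using same_fibre[of y0 "k n u"] y0 k_in[OF u] by metis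
    then obtain g where g: "\<And>n. g n \<in> carrier G" "\<And>n. act (g n) y0 = k n u" by metis
    have dist_g: "dE (k n u) (act h y0) = d (g n) h" if "h \<in> carrier G" for n h
      using orbit_isometry[OF g(1)[of n] that y0(1)] g(2) by simp
    have "Gm.MCauchy g"
      unfolding Gm.MCauchy_def
    proof (intro conjI allI impI)
      fix \<epsilon> :: real assume "\<epsilon> > 0"
      then obtain N where "\<And>n m. n \<ge> N \<Longrightarrow> m \<ge> N \<Longrightarrow> dE (k n u) (k m u) < \<epsilon>" using Cauchy u by metis
      then show "\<exists>N. \<forall>n n'. N \<le> n \<longrightarrow> N \<le> n' \<longrightarrow> d (g n) (g n') < \<epsilon>"
        using dist_g[OF g(1)] g(2) by metis
    qed (use g in auto)
    moreover have "Gm.mcomplete" using compact Gm.compact_space_eq_mcomplete_mtotally_bounded by blast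
    ultimately obtain h where h: "limitin Gm.mtopology g h sequentially" unfolding Gm.mcomplete_def by blast
    then have hc: "h \<in> carrier G" using Gm.limit_metric_sequentially by blast
    have "\<forall>\<epsilon>>0. \<exists>N. \<forall>n\<ge>N. dE (k n u) (act h y0) < \<epsilon>"
      using h unfolding Gm.limit_metric_sequentially dist_g[OF hc] by blast
    then show ?thesis using hc y0 act_closed p_act by (intro bexI[of _ "act h y0"]) auto
  qed
  then obtain \<kappa> where \<kappa>: "\<And>u. u \<in> {0..1} \<Longrightarrow> \<kappa> u \<in> E" "\<And>u. u \<in> {0..1} \<Longrightarrow> p (\<kappa> u) = \<gamma> u"
    "\<And>u \<epsilon>. u \<in> {0..1} \<Longrightarrow> \<epsilon> > 0 \<Longrightarrow> \<exists>N. \<forall>n\<ge>N. dE (k n u) (\<kappa> u) < \<epsilon>" by metis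
  have uniform: "\<exists>N. \<forall>n\<ge>N. \<forall>u\<in>{0..1}. dE (k n u) (\<kappa> u) < \<epsilon>" if \<epsilon>: "\<epsilon> > 0" for \<epsilon>
  proof -
    obtain N where N: "\<And>n m u. n \<ge> N \<Longrightarrow> m \<ge> N \<Longrightarrow> u \<in> {0..1} \<Longrightarrow> dE (k n u) (k m u) < \<epsilon> / 2"
      using Cauchy[OF half_gt_zero[OF \<epsilon>]] by blast
    have "dE (k n u) (\<kappa> u) < \<epsilon>" if n: "n \<ge> N" and u: "u \<in> {0..1}" for n u
    proof -
      obtain N' where "\<And>m. m \<ge> N' \<Longrightarrow> dE (k m u) (\<kappa> u) < \<epsilon> / 2" using \<kappa>(3)[OF u half_gt_zero[OF \<epsilon>]] by blast
      then have "dE (k (max N N') u) (\<kappa> u) < \<epsilon> / 2" by simp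
      moreover have "dE (k n u) (k (max N N') u) < \<epsilon> / 2" using N n u by simp
      ultimately show ?thesis
        using E.triangle[of "k n u" "k (max N N') u" "\<kappa> u"] k_in[OF u] \<kappa>(1)[OF u] by fastforce
    qed
    then show ?thesis by blast
  qed
  show thesis
  proof
    fix \<delta> :: real assume \<delta>: "\<delta> > 0"
    obtain N where N: "\<And>n u. n \<ge> N \<Longrightarrow> u \<in> {0..1} \<Longrightarrow> dE (k n u) (\<kappa> u) < \<delta> / 3"
      using uniform[of "\<delta> / 3"] \<delta> by force
    obtain N' where N': "\<And>n. n \<ge> N' \<Longrightarrow> 1 / real (Suc n) < \<delta> / 3" using small[of "\<delta> / 3"] \<delta> by auto
    let ?n = "max N N'"
    have "1 / real (Suc ?n) \<le> \<delta> / 3" by (rule less_imp_le[OF N'[OF max.cobounded2]])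
    then have "coarse_path (\<delta> / 3) (k ?n)"
      unfolding k_def by (rule coarse_mono[OF K(1), rotated]) simp
    then obtain \<eta> where \<eta>: "\<eta> > 0"
      "\<And>u v. u \<in> {0..1} \<Longrightarrow> v \<in> {0..1} \<Longrightarrow> \<bar>u - v\<bar> < \<eta> \<Longrightarrow> dE (k ?n u) (k ?n v) < \<delta> / 3"
      unfolding coarse_path_def by blast
    have "dE (\<kappa> u) (\<kappa> v) < \<delta>" if uv: "u \<in> {0..1}" "v \<in> {0..1}" "\<bar>u - v\<bar> < \<eta>" for u v
    proof -
      have "dE (\<kappa> u) (\<kappa> v) \<le> dE (\<kappa> u) (k ?n u) + dE (k ?n u) (\<kappa> v)"
        "dE (k ?n u) (\<kappa> v) \<le> dE (k ?n u) (k ?n v) + dE (k ?n v) (\<kappa> v)"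
        by (intro E.triangle \<kappa>(1) k_in uv)+
      then show ?thesis
        using N[of ?n u] N[of ?n v] uv \<eta>(2)[OF uv] E.commute[of "\<kappa> u" "k ?n u"] by simp
    qed
    then show "coarse_path \<delta> \<kappa>" unfolding coarse_path_def using \<kappa>(1) \<eta>(1) by blast
  next
    have "dE x (\<kappa> 0) < \<epsilon>" if \<epsilon>: "\<epsilon> > 0" for \<epsilon>
    proof -
      obtain N where N: "\<And>n u. n \<ge> N \<Longrightarrow> u \<in> {0..1} \<Longrightarrow> dE (k n u) (\<kappa> u) < \<epsilon> / 2"
        using uniform[OF half_gt_zero[OF \<epsilon>]] by blast
      obtain N' where N': "\<And>n. n \<ge> N' \<Longrightarrow> 1 / real (Suc n) < \<epsilon> / 2" using small[OF half_gt_zero[OF \<epsilon>]] by blast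
      let ?n = "max N N'"
      have "dE (k ?n 0) x < 1 / real (Suc ?n)" unfolding k_def by (rule K(3)) simp
      then show ?thesis
        using N[of ?n 0] N'[of ?n] E.triangle[of x "k ?n 0" "\<kappa> 0"] x(1) k_in(1)[of 0] \<kappa>(1)[of 0]
          E.commute[of x "k ?n 0"] by simp
    qed
    then have "dE x (\<kappa> 0) = 0" using E.nonneg by (metis less_irrefl order_le_less)
    then show "\<kappa> 0 = x" using x(1) \<kappa>(1)[of 0] by simp
  qed (rule \<kappa>(2))
qed

text \<open>
  Lifting each path \<open>u \<mapsto> H (x, u)\<close> separately leaves continuity in \<open>x\<close> to be shown. By compactness of
  the interval, for \<open>y\<close> near \<open>x\<close> the base paths \<open>H (x, _)\<close> and \<open>H (y, _)\<close> are uniformly close, and so are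
  their starting points upstairs; stability then keeps the lifts close at all times.
\<close>

lemma homotopy_lift_exists:
  assumes "lifting_problem X E.mtopology B.mtopology p \<phi> H"
  shows "\<exists>K. is_lift X E.mtopology p \<phi> H K"
proof -
  let ?I = "top_of_set {0..1::real}"
  have \<phi>: "continuous_map X E.mtopology \<phi>" and H: "continuous_map (prod_topology X ?I) B.mtopology H"
    and start: "\<And>x. x \<in> topspace X \<Longrightarrow> H (x, 0) = p (\<phi> x)"
    using assms unfolding lifting_problem_def by auto
  have \<phi>_in: "\<phi> x \<in> E" if "x \<in> topspace X" for x using continuous_map_funspace[OF \<phi>] that by auto
  have H_in: "H (x, u) \<in> B" if "x \<in> topspace X" "u \<in> {0..1}" for x u
    using continuous_map_funspace[OF H] that by auto
  have "\<exists>\<kappa>. (\<forall>\<delta>>0. coarse_path \<delta> \<kappa>) \<and> (\<forall>u\<in>{0..1}. p (\<kappa> u) = H (x, u)) \<and> \<kappa> 0 = \<phi> x"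
    if x: "x \<in> topspace X" for x
  proof -
    have 1: "(\<lambda>u. H (x, u)) \<in> {0..1} \<rightarrow> B" using H_in x by auto
    obtain \<kappa> where "\<And>\<delta>. \<delta> > 0 \<Longrightarrow> coarse_path \<delta> \<kappa>" "\<And>u. u \<in> {0..1} \<Longrightarrow> p (\<kappa> u) = H (x, u)" "\<kappa> 0 = \<phi> x"
      using path_lifting[OF 1 B.continuous_path_uniform[OF continuous_slice[OF H x]] \<phi>_in[OF x]] start[OF x]
      by auto
    then show ?thesis by blast
  qed
  then obtain k where k: "\<And>x \<delta>. x \<in> topspace X \<Longrightarrow> \<delta> > 0 \<Longrightarrow> coarse_path \<delta> (k x)"
    "\<And>x u. x \<in> topspace X \<Longrightarrow> u \<in> {0..1} \<Longrightarrow> p (k x u) = H (x, u)"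
    "\<And>x. x \<in> topspace X \<Longrightarrow> k x 0 = \<phi> x" by metis
  have k_in: "k x u \<in> E" if "x \<in> topspace X" "u \<in> {0..1}" for x u
    using k(1)[OF that(1), of 1] that by (auto simp: coarse_path_def)
  define K where "K = (\<lambda>(x, u). k x u)"
  have "continuous_map (prod_topology X ?I) E.mtopology K"
    unfolding E.continuous_map_to_metric
  proof (intro ballI allI impI)
    fix z and \<epsilon> :: real assume "z \<in> topspace (prod_topology X ?I)" and \<epsilon>: "\<epsilon> > 0"
    then obtain x u where z: "z = (x, u)" and x: "x \<in> topspace X" and u: "u \<in> {0..1}" by auto
    obtain \<delta> where \<delta>: "\<delta> > 0"
      "\<And>\<kappa> \<kappa>' u. coarse_path \<delta> \<kappa> \<Longrightarrow> coarse_path \<delta> \<kappa>' \<Longrightarrow> dE (\<kappa> 0) (\<kappa>' 0) < \<delta> \<Longrightarrow>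
        (\<And>v. v \<in> {0..1} \<Longrightarrow> dB (p (\<kappa> v)) (p (\<kappa>' v)) < \<delta>) \<Longrightarrow> u \<in> {0..1} \<Longrightarrow> dE (\<kappa> u) (\<kappa>' u) < \<epsilon> / 2"
      using coarse_path_stability[of "\<epsilon> / 2"] \<epsilon> by (metis half_gt_zero)
    obtain A where A: "openin X A" "x \<in> A" "\<And>y. y \<in> A \<Longrightarrow> dE (\<phi> x) (\<phi> y) < \<delta>"
      using \<phi>[unfolded E.continuous_map_to_metric, rule_format, OF x \<delta>(1)] by auto
    \<comment> \<open>\<open>T\<close> is an open set containing the slice over \<open>x\<close>, so the tube lemma applies to it.\<close>
    define T where "T = {w \<in> topspace (prod_topology X ?I). dB (H (x, snd w)) (H w) < \<delta>}"
    have "openin (prod_topology X ?I) T"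
    proof (subst openin_subopen, intro ballI)
      fix w assume "w \<in> T"
      then obtain y v where w: "w = (y, v)" and y: "y \<in> topspace X" and v: "v \<in> {0..1}"
        and near: "dB (H (x, v)) (H (y, v)) < \<delta>" unfolding T_def by auto
      define r where "r = (\<delta> - dB (H (x, v)) (H (y, v))) / 2"
      have r: "r > 0" using near by (simp add: r_def)
      obtain S where S: "openin (prod_topology X ?I) S" "w \<in> S" "\<And>q. q \<in> S \<Longrightarrow> dB (H w) (H q) < r"
        using H[unfolded B.continuous_map_to_metric, rule_format, of w, OF _ r] y v w by auto
      obtain V where V: "openin ?I V" "v \<in> V" "\<And>q. q \<in> V \<Longrightarrow> dB (H (x, v)) (H (x, q)) < r"
        using continuous_slice[OF H x, unfolded B.continuous_map_to_metric, rule_format, of v, OF _ r] v by auto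
      have "S \<inter> (topspace X \<times> V) \<subseteq> T"
      proof
        fix q assume q: "q \<in> S \<inter> (topspace X \<times> V)"
        then obtain a b where ab: "q = (a, b)" "a \<in> topspace X" "b \<in> V" by auto
        have b: "b \<in> {0..1}" using ab openin_subset[OF V(1)] by auto
        have "dB (H (x, b)) (H q) \<le> dB (H (x, b)) (H (x, v)) + dB (H (x, v)) (H q)"
          "dB (H (x, v)) (H q) \<le> dB (H (x, v)) (H w) + dB (H w) (H q)"
          using ab b w x y v H_in by (auto intro!: B.triangle)
        then have "dB (H (x, b)) (H q) < \<delta>"
          using V(3)[OF ab(3)] S(3)[of q] q B.commute[of "H (x, b)"] w by (auto simp: r_def field_simps)
        then show "q \<in> T" using ab b by (simp add: T_def)
      qed
      moreover have "openin (prod_topology X ?I) (S \<inter> (topspace X \<times> V))"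
        using S(1) V(1) by (intro openin_Int) (auto simp: openin_prod_Times_iff)
      moreover have "w \<in> S \<inter> (topspace X \<times> V)" using S V w y by auto
      ultimately show "\<exists>R. openin (prod_topology X ?I) R \<and> w \<in> R \<and> R \<subseteq> T" by blast
    qed
    moreover have "compactin ?I {0..1}" by (simp add: compactin_subtopology)
    moreover have "{x} \<times> {0..1} \<subseteq> T" using x \<delta>(1) H_in[OF x] by (auto simp: T_def)
    ultimately obtain U V where UV: "openin X U" "x \<in> U" "{0..1} \<subseteq> V" "U \<times> V \<subseteq> T"
      using tube_lemma_right[of X ?I T "{0..1}" x] x by blast
    obtain \<eta> where \<eta>: "\<eta> > 0" "\<And>u v. u \<in> {0..1} \<Longrightarrow> v \<in> {0..1} \<Longrightarrow> \<bar>u - v\<bar> < \<eta> \<Longrightarrow> dE (k x u) (k x v) < \<epsilon> / 2"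
      using k(1)[OF x, of "\<epsilon> / 2"] \<epsilon> unfolding coarse_path_def by auto
    let ?R = "(A \<inter> U) \<times> ({0..1} \<inter> ball u \<eta>)"
    have "openin (prod_topology X ?I) ?R"
      using A(1) UV(1) by (auto simp: openin_prod_Times_iff intro!: openin_Int openin_open_Int)
    moreover have "z \<in> ?R" using z A UV u \<eta> by auto
    moreover have "K q \<in> E.mball (K z) \<epsilon>" if "q \<in> ?R" for q
    proof -
      obtain y v where q: "q = (y, v)" "y \<in> A" "y \<in> U" "v \<in> {0..1}" "\<bar>u - v\<bar> < \<eta>"
        using \<open>q \<in> ?R\<close> by (auto simp: dist_real_def)
      have y: "y \<in> topspace X" using q A openin_subset by blast
      have "dE (k x v) (k y v) < \<epsilon> / 2"
      proof (rule \<delta>(2))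
        show "dB (p (k x t)) (p (k y t)) < \<delta>" if "t \<in> {0..1}" for t
          using UV(3,4) q(3) that k(2) x y by (fastforce simp: T_def)
      qed (use k x y \<delta>(1) A(3) q in auto)
      then have "dE (k x u) (k y v) < \<epsilon>"
        using \<eta>(2)[OF u q(4,5)] E.triangle[of "k x u" "k x v" "k y v"] k_in x y u q(4) by fastforce
      then show ?thesis using z q k_in x y u by (simp add: K_def)
    qed
    ultimately show "\<exists>U. openin (prod_topology X ?I) U \<and> z \<in> U \<and> (\<forall>y\<in>U. K y \<in> E.mball (K z) \<epsilon>)" by blast
  qed
  then show ?thesis using k by (intro exI[of _ K]) (auto simp: is_lift_def K_def)
qed

lemma homotopy_lift_unique:
  assumes K: "is_lift X E.mtopology p \<phi> H K" and K': "is_lift X E.mtopology p \<phi> H K'"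
    and z: "z \<in> topspace X \<times> {0..1}"
  shows "K' z = K z"
proof -
  obtain x u where xu: "z = (x, u)" "x \<in> topspace X" "u \<in> {0..1}" using z by auto
  have "coarse_path \<delta> (\<lambda>u. K (x, u))" "coarse_path \<delta> (\<lambda>u. K' (x, u))" if "\<delta> > 0" for \<delta>
    using K K' xu(2) that unfolding is_lift_def
    by (auto intro!: continuous_path_imp_coarse continuous_slice)
  then have "(\<lambda>u. K' (x, u)) u = (\<lambda>u. K (x, u)) u"
    using K K' xu unfolding is_lift_def
    by (intro unique_path_lifting[of "\<lambda>u. K' (x, u)" "\<lambda>u. K (x, u)" u]) auto
  then show ?thesis using xu by simp
qed

text \<open>
  Each short path from \<open>x\<close> to a translate \<open>g x\<close> projects to a small loop, whose lifts do not close up.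
  Composing the loop with a section gives a closed lift starting at the same point, which contradicts
  unique path lifting.
\<close>

lemma no_local_cross_section:
  assumes loops: "\<And>x r. x \<in> E \<Longrightarrow> r > 0 \<Longrightarrow> \<exists>g \<gamma>. g \<in> carrier G \<and> g \<noteq> \<one> \<and>
      continuous_map (top_of_set {0..1::real}) E.mtopology \<gamma> \<and> \<gamma> 0 = x \<and> \<gamma> 1 = act g x \<and>
      (\<forall>u\<in>{0..1}. dE x (\<gamma> u) < r)"
  shows "\<not> local_cross_section E.mtopology B.mtopology p U s"
proof
  assume "local_cross_section E.mtopology B.mtopology p U s"
  then have U: "openin B.mtopology U" "U \<noteq> {}"
    and s: "continuous_map (subtopology B.mtopology U) E.mtopology s" "\<And>b. b \<in> U \<Longrightarrow> p (s b) = b"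
    unfolding local_cross_section_def by auto
  obtain b where b: "b \<in> U" using U by blast
  then obtain r where r: "r > 0" "B.mball b r \<subseteq> U" using U(1) B.openin_mtopology by blast
  have bB: "b \<in> B" using b openin_subset[OF U(1)] by auto
  have s_in: "s b \<in> E" using continuous_map_funspace[OF s(1)] b bB by auto
  define x where "x = s b"
  have x: "x \<in> E" "p x = b" using s_in s(2)[OF b] by (auto simp: x_def)
  obtain g \<gamma> where g: "g \<in> carrier G" "g \<noteq> \<one>"
    and \<gamma>: "continuous_map (top_of_set {0..1::real}) E.mtopology \<gamma>" "\<gamma> 0 = x" "\<gamma> 1 = act g x"
      "\<And>u. u \<in> {0..1} \<Longrightarrow> dE x (\<gamma> u) < r"
    using loops[OF x(1) r(1)] by blast
  have \<gamma>_in: "\<gamma> u \<in> E" if "u \<in> {0..1}" for u using continuous_map_funspace[OF \<gamma>(1)] that by auto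
  have p\<gamma>: "p (\<gamma> u) \<in> U" if "u \<in> {0..1}" for u
  proof -
    have "dB b (p (\<gamma> u)) < r"
      using p_contract[OF x(1) \<gamma>_in[OF that]] \<gamma>(4)[OF that] x(2) by simp
    then show ?thesis using r(2) bB p_in[OF \<gamma>_in[OF that]] by auto
  qed
  \<comment> \<open>Both \<open>\<gamma>\<close> and \<open>s \<circ> p \<circ> \<gamma>\<close> lift the loop \<open>p \<circ> \<gamma>\<close> from \<open>x\<close>, so they end at the same point.\<close>
  have "continuous_map (top_of_set {0..1}) B.mtopology (p \<circ> \<gamma>)"
    by (rule continuous_map_compose[OF \<gamma>(1) continuous_p])
  then have "continuous_map (top_of_set {0..1}) (subtopology B.mtopology U) (p \<circ> \<gamma>)"
    using p\<gamma> by (auto simp: continuous_map_in_subtopology)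
  then have "continuous_map (top_of_set {0..1}) E.mtopology (s \<circ> (p \<circ> \<gamma>))"
    by (rule continuous_map_compose[OF _ s(1)])
  moreover have "s (p (\<gamma> 0)) = \<gamma> 0" using \<gamma>(2) x(2) by (simp add: x_def)
  ultimately have "(s \<circ> (p \<circ> \<gamma>)) 1 = \<gamma> 1"
    using \<gamma>(1) s(2) p\<gamma>
    by (intro unique_path_lifting[of "s \<circ> (p \<circ> \<gamma>)" \<gamma> 1] continuous_path_imp_coarse) auto
  moreover have "p (act g x) = b" using p_act[OF g(1) x(1)] x(2) by simp
  ultimately have "act g x = x" using \<gamma>(3) by (simp add: x_def)
  then have "d g \<one> = 0" using orbit_isometry[OF g(1) one_closed x(1)] x act_one by simp
  then show False using g by simp
qed

end

section \<open>Non-atomic standard Borel spaces\<close>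

text \<open>
  The leading term of such a series is exactly twice the largest possible sum of the later terms,
  so they cannot cancel it. This makes the coding by ternary digits below injective.
\<close>

lemma ternary_sum_nonzero:
  fixes c :: "nat \<Rightarrow> real"
  assumes bound: "\<And>i. \<bar>c i\<bar> \<le> 1" and first: "\<And>i. i < n \<Longrightarrow> c i = 0" and lead: "\<bar>c n\<bar> = 1"
  shows "(\<Sum>i. c i * (1 / 3) ^ i) \<noteq> 0"
proof
  let ?f = "\<lambda>i. c i * (1 / 3) ^ i" and ?q = "\<lambda>i. (1 / 3 :: real) ^ (i + Suc n)"
  assume "suminf ?f = 0"
  have le: "norm (?f i) \<le> (1 / 3) ^ i" for i
    using bound[of i] by (simp add: abs_mult mult_left_le_one_le)
  have "summable ?f"
    by (rule summable_comparison_test'[OF summable_geometric[of "1 / 3 :: real"] le]) simp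
  then have "suminf ?f = (\<Sum>i. ?f (i + Suc n)) + (\<Sum>i<Suc n. ?f i)"
    by (rule suminf_split_initial_segment)
  also have "(\<Sum>i<Suc n. ?f i) = c n * (1 / 3) ^ n" using first by simp
  finally have "\<bar>\<Sum>i. ?f (i + Suc n)\<bar> = (1 / 3) ^ n"
    using \<open>suminf ?f = 0\<close> lead by (simp add: abs_mult eq_neg_iff_add_eq_0[symmetric])
  moreover have q: "?q sums ((1 / 3) ^ Suc n * (1 / (1 - 1 / 3)))"
    using sums_mult[OF geometric_sums[of "1 / 3 :: real"], of "(1 / 3) ^ Suc n"]
    by (simp add: power_add mult.commute)
  have "\<bar>\<Sum>i. ?f (i + Suc n)\<bar> \<le> (\<Sum>i. ?q i)"
    using norm_suminf_le[of "\<lambda>i. ?f (i + Suc n)" ?q] le q sums_summable by fastforce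
  then have "\<bar>\<Sum>i. ?f (i + Suc n)\<bar> \<le> (1 / 3) ^ n / 2"
    using sums_unique[OF q] by simp
  ultimately have "(1 / 3 :: real) ^ n \<le> (1 / 3) ^ n / 2" by simp
  then show False by simp
qed

text \<open>
  A point is determined by the balls that contain it, with centres in a countable dense set and
  radii \<open>1/(n+1)\<close>; the sequence of these memberships is read as the digits, \<open>0\<close> or \<open>1\<close>, of a ternary expansion.
\<close>

lemma standard_borel_real_injection:
  fixes M :: "'w measure"
  assumes "standard_borel M"
  obtains \<phi> :: "'w \<Rightarrow> real" where "\<phi> \<in> borel_measurable M" "inj_on \<phi> (space M)"
    "\<And>t. \<phi> t \<in> {0..1}"
proof -
  obtain T where T: "completely_metrizable_space T" "separable_space T" "sets M = sets (borel_of T)"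
    using assms unfolding standard_borel_def by blast
  obtain S r where "Metric_space S r" and T_eq: "T = Metric_space.mtopology S r"
    using T(1) unfolding completely_metrizable_space_def by blast
  interpret S: Metric_space S r by fact
  have space: "space M = S" using sets_eq_imp_space_eq[OF T(3)] by (simp add: space_borel_of T_eq)
  obtain C where C: "countable C" "C \<subseteq> S" "S.mtopology closure_of C = S"
    using T(2) unfolding separable_space_def T_eq by auto
  \<comment> \<open>The empty set keeps the family nonempty, hence enumerable, even if the space is empty.\<close>
  define \<U> where "\<U> = insert {} ((\<lambda>(c, n). S.mball c (1 / real (Suc n))) ` (C \<times> UNIV))"
  have \<U>: "countable \<U>" "\<U> \<noteq> {}" unfolding \<U>_def using C(1) by auto
  define U where "U = from_nat_into \<U>"
  have U: "range U = \<U>" unfolding U_def using \<U> by (intro range_from_nat_into)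
  have U_sets: "U n \<in> sets M" for n
  proof -
    have "U n \<in> \<U>" using U by blast
    then have "openin T (U n)" unfolding \<U>_def T_eq by auto
    then show ?thesis using openin_borel_of T(3) by metis
  qed
  have separate: "\<exists>n. x \<in> U n \<and> y \<notin> U n" if xy: "x \<in> S" "y \<in> S" "x \<noteq> y" for x y
  proof -
    have "r x y / 2 > 0" using xy by simp
    then obtain n where n: "1 / real (Suc n) < r x y / 2"
      using nat_approx_posE[OF \<open>r x y / 2 > 0\<close>] by blast
    have "\<forall>q>0. \<exists>c\<in>C. c \<in> S.mball x q" using C(3) xy(1) unfolding S.metric_closure_of by blast
    then have "\<exists>c\<in>C. c \<in> S.mball x (1 / real (Suc n))" by (rule allE[of _ "1 / real (Suc n)"]) simp
    then obtain c where c: "c \<in> C" "r x c < 1 / real (Suc n)" by auto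
    let ?V = "S.mball c (1 / real (Suc n))"
    have "?V \<in> \<U>" unfolding \<U>_def using c by auto
    moreover have "x \<in> ?V" using c C(2) xy S.commute by auto
    moreover have "y \<notin> ?V"
      using S.triangle[of x c y] c(1) c(2) n C(2) xy by auto
    ultimately show ?thesis using U by (metis imageE)
  qed
  let ?b = "\<lambda>t i. indicator (U i) t * (1 / 3 :: real) ^ i"
  define \<phi> where "\<phi> t = (\<Sum>i. ?b t i) / 2" for t
  have le: "?b t i \<le> (1 / 3) ^ i" "0 \<le> ?b t i" for t i by (auto simp: indicator_def)
  have summ: "summable (?b t)" for t
    by (rule summable_comparison_test'[OF summable_geometric[of "1 / 3 :: real"]]) (auto simp: indicator_def)
  show thesis
  proof
    show "\<phi> \<in> borel_measurable M" unfolding \<phi>_def using U_sets by measurable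
    show "inj_on \<phi> (space M)"
    proof (rule inj_onI, rule ccontr)
      fix x y assume xy: "x \<in> space M" "y \<in> space M" "\<phi> x = \<phi> y" "x \<noteq> y"
      let ?c = "\<lambda>i. indicator (U i) x - indicator (U i) y :: real"
      have "\<exists>i. ?c i \<noteq> 0" using separate[of x y] xy space by (auto simp: indicator_def)
      define n where "n = (LEAST i. ?c i \<noteq> 0)"
      have n: "?c n \<noteq> 0" unfolding n_def using \<open>\<exists>i. ?c i \<noteq> 0\<close> by (rule LeastI_ex)
      have "?c i = 0" if "i < n" for i using not_less_Least[of i "\<lambda>i. ?c i \<noteq> 0"] that n_def by blast
      then have "(\<Sum>i. ?c i * (1 / 3) ^ i) \<noteq> 0"
        using n by (intro ternary_sum_nonzero[of _ n]) (auto simp: indicator_def split: if_splits)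
      moreover have "(\<Sum>i. ?c i * (1 / 3) ^ i) = (\<Sum>i. ?b x i) - (\<Sum>i. ?b y i)"
        using suminf_diff[OF summ summ, of x y] by (simp add: left_diff_distrib)
      ultimately show False using xy(3) by (simp add: \<phi>_def)
    qed
    show "\<phi> t \<in> {0..1}" for t
    proof -
      have "(\<Sum>i. ?b t i) \<le> (\<Sum>i. (1 / 3) ^ i)"
        by (rule suminf_le[OF le(1) summ summable_geometric]) simp
      then have "(\<Sum>i. ?b t i) \<le> 3 / 2" using suminf_geometric[of "1 / 3 :: real"] by simp
      moreover have "0 \<le> (\<Sum>i. ?b t i)" by (rule suminf_nonneg[OF summ le(2)])
      ultimately show ?thesis by (simp add: \<phi>_def)
    qed
  qed
qed

text \<open>
  A level set of an injection has at most one point, so it has no proper nonempty subset, and positive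
  measure would make it an atom.
\<close>

lemma non_atomic_level_null:
  assumes M: "non_atomic M" and \<phi>: "\<phi> \<in> borel_measurable M" "inj_on \<phi> (space M)"
  shows "measure M {t \<in> space M. \<phi> t = (c :: real)} = 0"
proof (rule ccontr)
  let ?A = "{t \<in> space M. \<phi> t = c}"
  assume "measure M ?A \<noteq> 0"
  then have "emeasure M ?A \<noteq> 0" by (auto simp: measure_def)
  moreover have "?A \<in> sets M" using \<phi>(1) by measurable
  ultimately obtain B where B: "B \<subseteq> ?A" "0 < emeasure M B" "emeasure M B < emeasure M ?A"
    using M[unfolded non_atomic_def, rule_format, of ?A] by (auto simp: zero_less_iff_neq_zero)
  then have "B \<noteq> {}" by auto
  then obtain b where b: "b \<in> B" by blast
  have "?A \<subseteq> {b}" using b B(1) inj_onD[OF \<phi>(2)] by blast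
  then have "B = ?A" using b B(1) by blast
  then show False using B(3) by simp
qed

section \<open>Paths of measurable maps\<close>

context L_setting
begin

lemma translated_on_measurable:
  assumes A: "A \<in> sets M" and f: "f \<in> borel_maps M G d" and g: "g \<in> carrier G"
  shows "(\<lambda>t. if t \<in> A then g \<otimes> f t else f t) \<in> borel_maps M G d"
  using f meas_translate[OF g f] A unfolding borel_maps_eq by (intro measurable_If_set) auto

text \<open>
  By right invariance, translating by \<open>g\<close> moves every value \<open>f t\<close> by the same amount \<open>d \<one> g\<close>, so only
  the measure of the set where the two maps differ matters.
\<close>

lemma integral_dist_translated_on:
  assumes A: "A \<in> sets M" "A' \<in> sets M" and f: "f \<in> borel_maps M G d" and g: "g \<in> carrier G"
  shows "(LINT t|M. d (if t \<in> A then g \<otimes> f t else f t) (if t \<in> A' then g \<otimes> f t else f t)) =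
    measure M ((A - A') \<union> (A' - A)) * d \<one> g"
proof -
  have "d (f t) (g \<otimes> f t) = d \<one> g" "d (g \<otimes> f t) (f t) = d \<one> g" if "t \<in> space M" for t
    using right_inv[OF meas_carrier[OF f that] one_closed g] meas_carrier[OF f that]
      commute[of "g \<otimes> f t" "f t"] by simp_all
  then have "(LINT t|M. d (if t \<in> A then g \<otimes> f t else f t) (if t \<in> A' then g \<otimes> f t else f t)) =
      (LINT t|M. indicator ((A - A') \<union> (A' - A)) t * d \<one> g)"
    using meas_carrier[OF f] g by (intro Bochner_Integration.integral_cong) (auto simp: indicator_def)
  also have "\<dots> = measure M ((A - A') \<union> (A' - A)) * d \<one> g"
    using A by (simp add: Int_absorb2 sets.sets_into_space)
  finally show ?thesis .
qed

text \<open>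
  The path moves \<open>f\<close> to \<open>g f\<close> by translating it on a growing part \<open>{\<phi> \<le> u}\<close> of the probability space.
  It is continuous because the distribution function of \<open>\<phi>\<close> has no jumps, and it never leaves the ball
  of radius \<open>d \<one> g\<close> around its start. Thus the points of an orbit are connected by paths in \<open>L(G)\<close> even
  when \<open>G\<close> is totally disconnected.
\<close>

lemma short_path_to_translate:
  fixes \<phi> :: "'w \<Rightarrow> real"
  assumes \<phi>: "\<phi> \<in> borel_measurable M" "\<And>t. \<phi> t \<in> {0..1}"
    and null: "\<And>c. measure M {t \<in> space M. \<phi> t = c} = 0"
    and F: "F \<in> L_space M G d" and g: "g \<in> carrier G"
  obtains \<gamma> where "continuous_map (top_of_set {0..1::real}) (L_topology M G d) \<gamma>"
    "\<gamma> 0 = F" "\<gamma> 1 = L_act M G d g F" "\<And>u. L_dist M d F (\<gamma> u) \<le> d \<one> g"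
proof -
  interpret L: Metric_space "L_space M G d" "L_dist M d" by (rule L_metric)
  obtain f where f: "f \<in> borel_maps M G d" "f \<in> F" using F L_spaceE by blast
  define A where "A u = {t \<in> space M. \<phi> t \<le> u}" for u
  define m where "m u = measure M (A u)" for u
  have A: "A u \<in> sets M" for u unfolding A_def using \<phi>(1) by measurable
  define h where "h B t = (if t \<in> B then g \<otimes> f t else f t)" for B t
  define \<gamma> where "\<gamma> u = ae_rel M G d `` {h (A u)}" for u
  have h_maps: "h B \<in> borel_maps M G d" if "B \<in> sets M" for B
    using translated_on_measurable[OF that f(1) g] unfolding h_def .
  have \<gamma>: "\<gamma> u \<in> L_space M G d" "h (A u) \<in> \<gamma> u" for u
    unfolding \<gamma>_def L_space_def
    by (rule quotientI[OF h_maps[OF A]], rule equiv_class_self[OF equiv_ae h_maps[OF A]])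
  have dist_h: "(LINT t|M. d (h B t) (h B' t)) = measure M ((B - B') \<union> (B' - B)) * d \<one> g"
    if "B \<in> sets M" "B' \<in> sets M" for B B'
    using integral_dist_translated_on[OF that f(1) g] unfolding h_def .
  have h_empty: "h {} = f" by (auto simp: h_def)
  have dist_F: "L_dist M d F (\<gamma> u) = m u * d \<one> g" for u
    using L_dist_eq[OF F \<gamma>(1) f(2) \<gamma>(2), of u] dist_h[of "{}" "A u"] A by (simp add: h_empty m_def)
  have dist_\<gamma>: "L_dist M d (\<gamma> u) (\<gamma> v) = \<bar>m u - m v\<bar> * d \<one> g" for u v
  proof -
    have *: "L_dist M d (\<gamma> u) (\<gamma> v) = \<bar>m u - m v\<bar> * d \<one> g" if "u \<le> v" for u v
    proof -
      have sub: "A u \<subseteq> A v" using that by (auto simp: A_def)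
      then have "m v - m u = measure M (A v - A u)"
        unfolding m_def using A by (simp add: finite_measure_Diff)
      then have "measure M (A v - A u) = \<bar>m u - m v\<bar>"
        using measure_nonneg[of M "A v - A u"] by linarith
      moreover have "(A u - A v) \<union> (A v - A u) = A v - A u" using sub by blast
      ultimately show ?thesis
        using L_dist_eq[OF \<gamma>(1) \<gamma>(1) \<gamma>(2) \<gamma>(2), of u v] dist_h[OF A A, of u v] by simp
    qed
    show ?thesis using *[of u v] *[of v u] L.commute[of "\<gamma> u" "\<gamma> v"] by (cases "u \<le> v") auto
  qed
  have cont_m: "isCont m u" for u
  proof -
    interpret D: real_distribution "distr M borel \<phi>" using \<phi>(1) by (rule real_distribution_distr)
    have "cdf (distr M borel \<phi>) = m"
      using \<phi>(1) by (auto simp: cdf_def2 measure_distr m_def A_def vimage_def Int_def conj_commute)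
    moreover have "measure (distr M borel \<phi>) {u} = 0"
      using \<phi>(1) null[of u] by (simp add: measure_distr vimage_def Int_def conj_commute)
    ultimately show ?thesis using D.isCont_cdf by metis
  qed
  show thesis
  proof
    show "continuous_map (top_of_set {0..1}) (L_topology M G d) \<gamma>"
      unfolding L_topology_def L.continuous_map_to_metric
    proof (intro ballI allI impI)
      fix u :: real and \<epsilon> :: real assume u: "u \<in> topspace (top_of_set {0..1})" and \<epsilon>: "\<epsilon> > 0"
      have pos: "d \<one> g + 1 > 0" using nonneg[of \<one> g] by linarith
      then have "\<epsilon> / (d \<one> g + 1) > 0" using \<epsilon> by simp
      then obtain \<delta> where \<delta>: "\<delta> > 0" "\<And>v. dist v u < \<delta> \<Longrightarrow> dist (m v) (m u) < \<epsilon> / (d \<one> g + 1)"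
        using cont_m[of u] unfolding continuous_at_eps_delta by metis
      have "\<gamma> v \<in> L.mball (\<gamma> u) \<epsilon>" if "v \<in> {0..1} \<inter> ball u \<delta>" for v
      proof -
        have "\<bar>m u - m v\<bar> < \<epsilon> / (d \<one> g + 1)"
          using \<delta>(2)[of v] that by (simp add: dist_commute dist_real_def abs_minus_commute)
        then have "\<bar>m u - m v\<bar> * (d \<one> g + 1) < \<epsilon>"
          using pos by (simp add: pos_less_divide_eq)
        moreover have "\<bar>m u - m v\<bar> * d \<one> g \<le> \<bar>m u - m v\<bar> * (d \<one> g + 1)" by (intro mult_left_mono) auto
        ultimately show ?thesis using \<gamma>(1) dist_\<gamma>[of u v] by simp
      qed
      moreover have "openin (top_of_set {0..1}) ({0..1} \<inter> ball u \<delta>)" by (intro openin_open_Int) simp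
      ultimately show "\<exists>U. openin (top_of_set {0..1}) U \<and> u \<in> U \<and> (\<forall>v\<in>U. \<gamma> v \<in> L.mball (\<gamma> u) \<epsilon>)"
        using u \<delta>(1) by (intro exI[of _ "{0..1} \<inter> ball u \<delta>"]) auto
    qed
    have "A 0 = {t \<in> space M. \<phi> t = 0}" using \<phi>(2) by (auto simp: A_def intro: antisym)
    then have "m 0 = 0" using null[of 0] by (simp add: m_def)
    then have "L_dist M d F (\<gamma> 0) = 0" using dist_F[of 0] by simp
    then show "\<gamma> 0 = F" using F \<gamma>(1) by simp
    have "A 1 = space M" using \<phi>(2) by (auto simp: A_def)
    then have "(LINT t|M. d (h (A 1) t) (g \<otimes> f t)) = 0"
      using g meas_carrier[OF f(1)] by (subst Bochner_Integration.integral_cong[where g = "\<lambda>_. 0"]) (auto simp: h_def)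
    then have "L_dist M d (\<gamma> 1) (L_act M G d g F) = 0"
      using L_dist_eq[OF \<gamma>(1) L_act_closed[OF g F] \<gamma>(2) L_act_mem[OF g F f(2)], of 1] by simp
    then show "\<gamma> 1 = L_act M G d g F" using \<gamma>(1) L_act_closed[OF g F] by simp
    show "L_dist M d F (\<gamma> u) \<le> d \<one> g" for u
      unfolding dist_F by (simp add: m_def mult_left_le_one_le)
  qed
qed

text \<open>
  Right invariance of \<open>d\<close> yields the isometry of orbit maps, left invariance that of the action;
  the infimum defining the quotient metric is attained by compactness of \<open>G\<close>.
\<close>

lemma isometric_action:
  assumes "\<And>C. connectedin mtopology C \<Longrightarrow> \<exists>a. C \<subseteq> {a}"
  shows "profinite_isometric_action G d (L_space M G d) (L_dist M d)
    (L_quotient M G d) (L_quotient_dist M G d) (L_act M G d) (L_proj M G d)"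
proof -
  interpret E: Metric_space "L_space M G d" "L_dist M d" by (rule L_metric)
  interpret B: Metric_space "L_quotient M G d" "L_quotient_dist M G d" by (rule L_quotient_metric)
  show ?thesis
  proof
    show "L_proj M G d (L_act M G d g F) = L_proj M G d F" if "g \<in> carrier G" "F \<in> L_space M G d" for g F
    proof -
      have "L_act M G d g F \<in> L_proj M G d F" using that(1) unfolding L_proj_def orbit_def by blast
      then show ?thesis using L_quotientE(2)[OF L_proj_in[OF that(2)]] by simp
    qed
    show "L_quotient_dist M G d (L_proj M G d F1) (L_proj M G d F2) \<le> L_dist M d F1 F2"
      if "F1 \<in> L_space M G d" "F2 \<in> L_space M G d" for F1 F2
      using L_quotient_dist_le[OF that one_closed] L_act_one[OF that(1)] by simp
    show "\<exists>g\<in>carrier G. L_quotient_dist M G d (L_proj M G d F1) (L_proj M G d F2) = L_dist M d (L_act M G d g F1) F2"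
      if "F1 \<in> L_space M G d" "F2 \<in> L_space M G d" for F1 F2
      using L_quotient_dist_attained[OF that] by metis
    show "\<exists>F\<in>L_space M G d. L_proj M G d F = C" if "C \<in> L_quotient M G d" for C
      using L_quotient_rep[OF that] by metis
  qed (use assms compact in \<open>auto simp: L_act_closed L_act_one L_dist_act L_dist_act_same L_proj_in\<close>)
qed

end

theorem proposition4p17:
  fixes G :: "('g, 'm) monoid_scheme" and d :: "'g \<Rightarrow> 'g \<Rightarrow> real" and M :: "'w measure"
  assumes "standard_borel M" and "uncountable (space M)" and "prob_space M" and "non_atomic M"
    and "Metric_space (carrier G) d"
    and "profinite_group G (group_topology G d)"
    and "bi_invariant G d"
    and "\<exists>g :: nat \<Rightarrow> 'g. (\<forall>n. g n \<in> carrier G - {\<one>\<^bsub>G\<^esub>}) \<and>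
           limitin (group_topology G d) g \<one>\<^bsub>G\<^esub> sequentially"
  shows "continuous_map (L_topology M G d) (L_quotient_topology M G d) (L_proj M G d) \<and>
     (\<nexists>U s. local_cross_section (L_topology M G d) (L_quotient_topology M G d) (L_proj M G d) U s) \<and>
     hurewicz_fibration TYPE('x) (L_topology M G d) (L_quotient_topology M G d) (L_proj M G d) \<and>
     (\<forall>X :: 'x topology.
        unique_homotopy_lifting_property X (L_topology M G d) (L_quotient_topology M G d) (L_proj M G d))"
proof -
  interpret Gm: Metric_space "carrier G" d by fact
  have "group G" "compact_space Gm.mtopology"
    and totally_disconnected: "\<And>C. connectedin Gm.mtopology C \<Longrightarrow> \<exists>a. C \<subseteq> {a}"
    using assms(6) unfolding profinite_group_def topological_group_def group_topology_def by auto
  then interpret L_setting G d M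
    using assms(3,5,7) by (intro L_setting.intro L_setting_axioms.intro)
  interpret P: profinite_isometric_action G d "L_space M G d" "L_dist M d"
    "L_quotient M G d" "L_quotient_dist M G d" "L_act M G d" "L_proj M G d"
    using isometric_action totally_disconnected by blast
  note top = L_topology_def L_quotient_topology_def
  obtain \<phi> :: "'w \<Rightarrow> real" where \<phi>: "\<phi> \<in> borel_measurable M" "inj_on \<phi> (space M)" "\<And>t. \<phi> t \<in> {0..1}"
    using standard_borel_real_injection[OF assms(1)] by metis
  have "\<exists>g \<gamma>. g \<in> carrier G \<and> g \<noteq> \<one>\<^bsub>G\<^esub> \<and>
      continuous_map (top_of_set {0..1::real}) P.E.mtopology \<gamma> \<and> \<gamma> 0 = F \<and> \<gamma> 1 = L_act M G d g F \<and>
      (\<forall>u\<in>{0..1}. L_dist M d F (\<gamma> u) < r)" if F: "F \<in> L_space M G d" and r: "r > 0" for F r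
  proof -
    obtain g where g: "g \<in> carrier G" "g \<noteq> \<one>\<^bsub>G\<^esub>" "d \<one>\<^bsub>G\<^esub> g < r"
      using assms(8) r unfolding group_topology_def Gm.limit_metric_sequentially
      by (metis Diff_iff Gm.commute insertI1 order_refl)
    obtain \<gamma> where "continuous_map (top_of_set {0..1::real}) (L_topology M G d) \<gamma>"
      "\<gamma> 0 = F" "\<gamma> 1 = L_act M G d g F" "\<And>u. L_dist M d F (\<gamma> u) \<le> d \<one>\<^bsub>G\<^esub> g"
      using short_path_to_translate[OF \<phi>(1,3) non_atomic_level_null[OF assms(4) \<phi>(1,2)] F g(1)] by metis
    then show ?thesis using g unfolding top by (intro exI[of _ g] exI[of _ \<gamma>]) (auto intro: le_less_trans)
  qed
  then have "\<nexists>U s. local_cross_section (L_topology M G d) (L_quotient_topology M G d) (L_proj M G d) U s"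
    unfolding top using P.no_local_cross_section by blast
  moreover have "hurewicz_fibration TYPE('x) (L_topology M G d) (L_quotient_topology M G d) (L_proj M G d)"
    unfolding hurewicz_fibration_def homotopy_lifting_property_def top
    using P.continuous_p P.homotopy_lift_exists by blast
  moreover have "unique_homotopy_lifting_property X (L_topology M G d) (L_quotient_topology M G d) (L_proj M G d)"
    for X :: "'x topology"
    unfolding unique_homotopy_lifting_property_def top
    using P.homotopy_lift_exists P.homotopy_lift_unique by metis
  ultimately show ?thesis using P.continuous_p unfolding top by blast
qed

end
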